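(* Let $n\ge3$ and consider the spherically symmetric Finsler metric $F(x,y)=u\,\phi(r,s)$ with $$\phi(r,s)=\sqrt{r^2+c_1s^2+c_2s\sqrt{r^2-s^2}}\;\exp\left(\frac{c_2}{\sqrt{c_2^2-4c_1-4}}\operatorname{arctanh}\left(\frac{c_2s+2\sqrt{r^2-s^2}}{s\sqrt{c_2^2-4c_1-4}}\right)\right),$$ where $c_1,c_2\in\mathbb{R}$ satisfy $c_2\neq0$ and $c_2^2-4c_1-4\neq0$. Then $F$ is a non-regular Landsberg metric which is not Berwaldian. The associated spray coefficients $G^i=uPy^i+u^2Qx^i$ are determined by $$P=\frac{s}{r^2}+\frac{c_2\sqrt{r^2-s^2}}{r^2(c_1+1)},\qquad Q=\frac{c_1-1}{2r^2(c_1+1)}-\frac{c_1s^2}{r^4(c_1+1)}-\frac{c_2s\sqrt{r^2-s^2}}{r^4(c_1+1)}.$$ Moreover, $F$ reduces to a Berwald metric if and only if $c_2=0$. If $c_2^2-4c_1-4<0$, the expression involving $\operatorname{arctanh}$ is replaced by $\arctan$ using the identity $I\cdot\operatorname{arctanh}(Iz)=\arctan(z)$, $I:=\sqrt{-1}$.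
   Context: A spherically symmetric Finsler metric is defined on an open ball $\mathbb{B}^n(r_0)\subset\mathbb{R}^n$ and has the form $F(x,y)=u\,\phi(r,s)$, where $r=|x|$, $u=|y|$, $s=\langle x,y\rangle/|y|$, with $\langle\cdot,\cdot\rangle$ and $|\cdot|$ the standard Euclidean inner product and norm. Subscripts $r,s$ on $\phi$ denote partial derivatives. For $n\ge3$ the regularity condition is that $\phi$ is smooth and positive with $\phi-s\phi_s>0$ and $\phi-s\phi_s+(r^2-s^2)\phi_{ss}>0$ for all $|s|\le r<r_0$; a metric is non-regular if it is not regular in this sense. The geodesic spray coefficients of $F$ are $G^i=uPy^i+u^2Qx^i$, where $$Q=\frac{1}{2r}\cdot\frac{-\phi_r+s\phi_{rs}+r\phi_{ss}}{\phi-s\phi_s+(r^2-s^2)\phi_{ss}},\qquad P=-\frac{Q}{\phi}\left(s\phi+(r^2-s^2)\phi_s\right)+\frac{1}{2r\phi}\left(s\phi_r+r\phi_s\right).$$ Put $G^i_{jkh}=\frac{\partial^3G^i}{\partial y^j\partial y^k\partial y^h}$ (the Berwald tensor) and $L_{jkh}=-\frac12F\,G^i_{jkh}\frac{\partial F}{\partial y^i}$ (the Landsberg tensor). $F$ is Berwald (Berwaldian) if $G^i_{jkh}=0$, and Landsberg if $L_{jkh}=0$.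
   Formalization: c_1 = -1 is excluded (P and Q divide by c_1+1 and F is degenerate there); for c_2^2-4c_1-4<0 the sign is corrected to arctanh(Iz) = I arctan(z), since the stated identity is false and would give an exponent for which the claimed P fails. *)

theory Defs
  imports "HOL-Analysis.Analysis"
begin

section \<open>Smooth functions\<close>

text \<open>Over a finite-dimensional domain, continuity of all iterated directional derivatives of
  order at most \<open>k\<close> is the usual notion of \<open>C\<^sup>k\<close>.\<close>

primrec Ck_on :: "nat \<Rightarrow> 'a::euclidean_space set \<Rightarrow> ('a \<Rightarrow> real) \<Rightarrow> bool" where
  "Ck_on 0 S f \<longleftrightarrow> continuous_on S f"
| "Ck_on (Suc k) S f \<longleftrightarrow>
     (\<forall>x\<in>S. f differentiable (at x)) \<and>
     (\<forall>v. Ck_on k S (\<lambda>x. frechet_derivative f (at x) v))"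

definition smooth_on :: "'a::euclidean_space set \<Rightarrow> ('a \<Rightarrow> real) \<Rightarrow> bool" where
  "smooth_on S f \<longleftrightarrow> open S \<and> (\<forall>k. Ck_on k S f)"


section \<open>Spherically symmetric Finsler metrics\<close>

definition d_r :: "(real \<Rightarrow> real \<Rightarrow> real) \<Rightarrow> real \<Rightarrow> real \<Rightarrow> real" where
  "d_r \<phi> r s = deriv (\<lambda>r'. \<phi> r' s) r"

definition d_s :: "(real \<Rightarrow> real \<Rightarrow> real) \<Rightarrow> real \<Rightarrow> real \<Rightarrow> real" where
  "d_s \<phi> r s = deriv (\<lambda>s'. \<phi> r s') s"

definition sph_metric :: "(real \<Rightarrow> real \<Rightarrow> real) \<Rightarrow> real^'n \<Rightarrow> real^'n \<Rightarrow> real" where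
  "sph_metric \<phi> x y = norm y * \<phi> (norm x) (x \<bullet> y / norm y)"

text \<open>The regularity condition in dimension at least 3. The region \<open>\<bar>s\<bar> \<le> r < r0\<close> is not open;
  smoothness on it means smoothness on an open neighbourhood.\<close>

definition regular_sph :: "real \<Rightarrow> (real \<Rightarrow> real \<Rightarrow> real) \<Rightarrow> bool" where
  "regular_sph r0 \<phi> \<longleftrightarrow>
     (\<exists>U. {(r, s). \<bar>s\<bar> \<le> r \<and> r < r0} \<subseteq> U \<and> smooth_on U (\<lambda>(r, s). \<phi> r s)) \<and>
     (\<forall>r s. \<bar>s\<bar> \<le> r \<and> r < r0 \<longrightarrow>
        \<phi> r s > 0 \<and>
        \<phi> r s - s * d_s \<phi> r s > 0 \<and>
        \<phi> r s - s * d_s \<phi> r s + (r\<^sup>2 - s\<^sup>2) * d_s (d_s \<phi>) r s > 0)"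

text \<open>A metric on a smaller set \<open>D\<close> of pairs \<open>(r, s)\<close>. The two non-vanishing conditions say that
  the fundamental tensor is nondegenerate, so that the geodesic spray exists; positive
  definiteness is not required.\<close>

definition sph_metric_on :: "(real \<times> real) set \<Rightarrow> (real \<Rightarrow> real \<Rightarrow> real) \<Rightarrow> bool" where
  "sph_metric_on D \<phi> \<longleftrightarrow>
     smooth_on D (\<lambda>(r, s). \<phi> r s) \<and>
     (\<forall>(r, s)\<in>D.
        \<phi> r s > 0 \<and>
        \<phi> r s - s * d_s \<phi> r s \<noteq> 0 \<and>
        \<phi> r s - s * d_s \<phi> r s + (r\<^sup>2 - s\<^sup>2) * d_s (d_s \<phi>) r s \<noteq> 0)"

text \<open>Only the values of \<open>\<phi>\<close> on \<open>D\<close> are used: no regular function on the full region agrees with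
  \<open>\<phi>\<close> on \<open>D\<close>. This way, the values of a formula for \<open>\<phi>\<close> at points where it is meaningless
  (division by zero, roots of negative numbers) play no role.\<close>

definition nonregular_sph :: "real \<Rightarrow> (real \<times> real) set \<Rightarrow> (real \<Rightarrow> real \<Rightarrow> real) \<Rightarrow> bool" where
  "nonregular_sph r0 D \<phi> \<longleftrightarrow>
     \<not> (\<exists>\<psi>. regular_sph r0 \<psi> \<and> (\<forall>(r, s)\<in>D. \<psi> r s = \<phi> r s))"

definition tangent_domain :: "(real \<times> real) set \<Rightarrow> ((real^'n) \<times> (real^'n)) set" where
  "tangent_domain D = {(x, y). y \<noteq> 0 \<and> (norm x, x \<bullet> y / norm y) \<in> D}"


section \<open>Spray coefficients, Berwald and Landsberg tensors\<close>

definition spray_Q :: "(real \<Rightarrow> real \<Rightarrow> real) \<Rightarrow> real \<Rightarrow> real \<Rightarrow> real" where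
  "spray_Q \<phi> r s = 1 / (2 * r) *
     ((- d_r \<phi> r s + s * d_r (d_s \<phi>) r s + r * d_s (d_s \<phi>) r s) /
      (\<phi> r s - s * d_s \<phi> r s + (r\<^sup>2 - s\<^sup>2) * d_s (d_s \<phi>) r s))"

definition spray_P :: "(real \<Rightarrow> real \<Rightarrow> real) \<Rightarrow> real \<Rightarrow> real \<Rightarrow> real" where
  "spray_P \<phi> r s =
     - (spray_Q \<phi> r s / \<phi> r s) * (s * \<phi> r s + (r\<^sup>2 - s\<^sup>2) * d_s \<phi> r s)
     + 1 / (2 * r * \<phi> r s) * (s * d_r \<phi> r s + r * d_s \<phi> r s)"

definition spray :: "(real \<Rightarrow> real \<Rightarrow> real) \<Rightarrow> real^'n \<Rightarrow> real^'n \<Rightarrow> real^'n" where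
  "spray \<phi> x y =
     (let u = norm y; r = norm x; s = x \<bullet> y / norm y
      in (u * spray_P \<phi> r s) *\<^sub>R y + (u\<^sup>2 * spray_Q \<phi> r s) *\<^sub>R x)"

definition pd :: "'n \<Rightarrow> (real^'n \<Rightarrow> real) \<Rightarrow> real^'n \<Rightarrow> real" where
  "pd j f y = deriv (\<lambda>t. f (y + t *\<^sub>R axis j 1)) 0"

definition berwald_tensor ::
    "(real^'n \<Rightarrow> real^'n \<Rightarrow> real^'n) \<Rightarrow> real^'n \<Rightarrow> real^'n \<Rightarrow> 'n \<Rightarrow> 'n \<Rightarrow> 'n \<Rightarrow> 'n \<Rightarrow> real" where
  "berwald_tensor G x y i j k h = pd j (pd k (pd h (\<lambda>y'. G x y' $ i))) y"

definition landsberg_tensor ::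
    "(real^'n \<Rightarrow> real^'n \<Rightarrow> real) \<Rightarrow> (real^'n \<Rightarrow> real^'n \<Rightarrow> real^'n) \<Rightarrow>
     real^'n \<Rightarrow> real^'n \<Rightarrow> 'n \<Rightarrow> 'n \<Rightarrow> 'n \<Rightarrow> real" where
  "landsberg_tensor F G x y j k h =
     - (1/2) * F x y * (\<Sum>i\<in>UNIV. berwald_tensor G x y i j k h * pd i (F x) y)"

definition berwald_on ::
    "((real^'n) \<times> (real^'n)) set \<Rightarrow> (real^'n \<Rightarrow> real^'n \<Rightarrow> real^'n) \<Rightarrow> bool" where
  "berwald_on \<Omega> G \<longleftrightarrow> (\<forall>(x, y)\<in>\<Omega>. \<forall>i j k h. berwald_tensor G x y i j k h = 0)"

definition landsberg_on ::
    "((real^'n) \<times> (real^'n)) set \<Rightarrow> (real^'n \<Rightarrow> real^'n \<Rightarrow> real) \<Rightarrow>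
     (real^'n \<Rightarrow> real^'n \<Rightarrow> real^'n) \<Rightarrow> bool" where
  "landsberg_on \<Omega> F G \<longleftrightarrow> (\<forall>(x, y)\<in>\<Omega>. \<forall>j k h. landsberg_tensor F G x y j k h = 0)"


section \<open>The metric\<close>

definition radicand :: "real \<Rightarrow> real \<Rightarrow> real \<Rightarrow> real \<Rightarrow> real" where
  "radicand c1 c2 r s = r\<^sup>2 + c1 * s\<^sup>2 + c2 * s * sqrt (r\<^sup>2 - s\<^sup>2)"

text \<open>For \<open>c2\<^sup>2 - 4 * c1 - 4 > 0\<close> and a positive radicand, the argument of \<open>artanh\<close> has absolute
  value greater than 1. There the real \<open>artanh\<close> of the library is
  \<open>ln \<bar>(1 + z) / (1 - z)\<bar> / 2\<close>, because \<open>ln\<close> is even on the reals.\<close>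

definition phi :: "real \<Rightarrow> real \<Rightarrow> real \<Rightarrow> real \<Rightarrow> real" where
  "phi c1 c2 r s =
     (let \<Delta> = c2\<^sup>2 - 4 * c1 - 4; N = c2 * s + 2 * sqrt (r\<^sup>2 - s\<^sup>2)
      in sqrt (radicand c1 c2 r s) *
         exp (if \<Delta> > 0
              then c2 / sqrt \<Delta> * artanh (N / (s * sqrt \<Delta>))
              else - (c2 / sqrt (- \<Delta>)) * arctan (N / (s * sqrt (- \<Delta>)))))"

definition phi_domain :: "real \<Rightarrow> real \<Rightarrow> real \<Rightarrow> (real \<times> real) set" where
  "phi_domain r0 c1 c2 = {(r, s). s \<noteq> 0 \<and> \<bar>s\<bar> < r \<and> r < r0 \<and> radicand c1 c2 r s > 0}"

lemma artanh_real_ln_abs: "artanh (z::real) = ln \<bar>(1 + z) / (1 - z)\<bar> / 2"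
  by (simp only: artanh_def abs_if ln_minus split: if_split) simp

text \<open>The next two lemmas relate \<open>phi\<close> to its single defining formula read over the complex
  numbers with principal branches: the two agree for a negative discriminant, and agree up to a
  constant factor of modulus 1 for a positive one.\<close>

definition phi_complex :: "real \<Rightarrow> real \<Rightarrow> real \<Rightarrow> real \<Rightarrow> complex" where
  "phi_complex c1 c2 r s =
     (let \<Delta> = complex_of_real (c2\<^sup>2 - 4 * c1 - 4);
          N = complex_of_real (c2 * s + 2 * sqrt (r\<^sup>2 - s\<^sup>2))
      in csqrt (of_real (radicand c1 c2 r s)) *
         exp (of_real c2 / csqrt \<Delta> * artanh (N / (of_real s * csqrt \<Delta>))))"

lemma artanh_ii: "artanh (\<i> * complex_of_real t) = \<i> * of_real (arctan t)"
proof -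
  have Re: "Re (1 + \<i> * complex_of_real t) > 0" "Re (1 - \<i> * complex_of_real t) > 0"
    by auto
  then have nz: "1 + \<i> * complex_of_real t \<noteq> 0" "1 - \<i> * complex_of_real t \<noteq> 0"
    by (metis less_irrefl zero_complex.sel(1))+
  have "\<i> * of_real (arctan t) = \<i> * Arctan (of_real t)"
    by (simp add: Arctan_of_real)
  also have "\<dots> = - (Ln ((1 - \<i> * of_real t) / (1 + \<i> * of_real t)) / 2)"
    by (simp add: Arctan_def algebra_simps)
  also have "\<dots> = Ln (inverse ((1 - \<i> * of_real t) / (1 + \<i> * of_real t))) / 2"
  proof -
    have "(1 - \<i> * of_real t) / (1 + \<i> * of_real t) \<notin> \<real>\<^sub>\<le>\<^sub>0"
    proof
      assume "(1 - \<i> * of_real t) / (1 + \<i> * of_real t) \<in> \<real>\<^sub>\<le>\<^sub>0"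
      then obtain a where a: "(1 - \<i> * of_real t) / (1 + \<i> * of_real t) = of_real a" "a \<le> 0"
        by (auto elim: nonpos_Reals_cases)
      then have "1 - \<i> * of_real t = of_real a * (1 + \<i> * of_real t)"
        using nz by (simp add: field_simps)
      then have "Re (1 - \<i> * of_real t) = Re (of_real a * (1 + \<i> * of_real t))"
        by (rule arg_cong)
      then show False using a by simp
    qed
    from Ln_inverse[OF this] show ?thesis by simp
  qed
  also have "\<dots> = artanh (\<i> * complex_of_real t)"
    by (simp add: artanh_def)
  finally show ?thesis by simp
qed

lemma phi_complex_neg_discriminant:
  assumes "c2\<^sup>2 - 4 * c1 - 4 < 0" and "radicand c1 c2 r s > 0"
  shows "phi_complex c1 c2 r s = of_real (phi c1 c2 r s)"
proof -
  define k where "k = sqrt (- (c2\<^sup>2 - 4 * c1 - 4))"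
  define N where "N = c2 * s + 2 * sqrt (r\<^sup>2 - s\<^sup>2)"
  have k: "k > 0" using assms by (simp add: k_def)
  have cs: "csqrt (complex_of_real (c2\<^sup>2 - 4 * c1 - 4)) = \<i> * of_real k"
    using assms(1) by (subst csqrt_of_real_nonpos) (auto simp: k_def)
  have "complex_of_real N / (of_real s * (\<i> * of_real k)) = \<i> * of_real (- (N / (s * k)))"
    using k by (cases "s = 0") (auto simp: field_simps)
  then have "artanh (complex_of_real N / (of_real s * (\<i> * of_real k)))
      = \<i> * of_real (arctan (- (N / (s * k))))"
    by (simp only: artanh_ii)
  then have "of_real c2 / (\<i> * of_real k) * artanh (complex_of_real N / (of_real s * (\<i> * of_real k)))
      = of_real (- (c2 / k) * arctan (N / (s * k)))"
    using k by (simp add: arctan_minus field_simps)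
  then show ?thesis
    using assms unfolding phi_complex_def phi_def Let_def cs N_def[symmetric] k_def[symmetric]
    by (simp add: csqrt_of_real_nonneg flip: exp_of_real)
qed

lemma phi_complex_pos_discriminant:
  assumes "c2\<^sup>2 - 4 * c1 - 4 > 0" and "(r, s) \<in> phi_domain r0 c1 c2"
  shows "phi_complex c1 c2 r s =
    exp (\<i> * of_real (pi * c2 / (2 * sqrt (c2\<^sup>2 - 4 * c1 - 4)))) * of_real (phi c1 c2 r s)"
proof -
  define k where "k = sqrt (c2\<^sup>2 - 4 * c1 - 4)"
  define w where "w = sqrt (r\<^sup>2 - s\<^sup>2)"
  define N where "N = c2 * s + 2 * w"
  define z where "z = N / (s * k)"
  have s: "s \<noteq> 0" "\<bar>s\<bar> < r" and A: "radicand c1 c2 r s > 0"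
    using assms by (auto simp: phi_domain_def)
  have k: "k > 0" "k\<^sup>2 = c2\<^sup>2 - 4 * c1 - 4" using assms by (auto simp: k_def)
  have "s\<^sup>2 < r\<^sup>2" using s by (metis abs_ge_zero power2_abs power_strict_mono zero_less_numeral)
  then have w: "w\<^sup>2 = r\<^sup>2 - s\<^sup>2" by (simp add: w_def)
  have "N\<^sup>2 - (s * k)\<^sup>2 = 4 * radicand c1 c2 r s"
    unfolding N_def radicand_def w_def[symmetric] power_mult_distrib k(2)
    using w by (simp add: power2_eq_square algebra_simps)
  then have "N\<^sup>2 > (s * k)\<^sup>2" using A by simp
  then have z2: "z\<^sup>2 > 1" using s k by (simp add: z_def power_divide)
  have z1: "1 - z \<noteq> 0" using z2 by auto
  have "(1 + z) * (1 - z) < 0" using z2 by (simp add: algebra_simps power2_eq_square)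
  then have neg: "(1 + z) / (1 - z) < 0"
    by (auto simp: mult_less_0_iff divide_less_0_iff)
  have "artanh (complex_of_real z) = Ln (of_real ((1 + z) / (1 - z))) / 2"
    by (simp add: artanh_def)
  also have "\<dots> = of_real (artanh z) + \<i> * of_real (pi / 2)"
    using neg by (subst Ln_of_real') (auto simp: artanh_real_ln_abs field_simps)
  finally have at: "artanh (complex_of_real z) = of_real (artanh z) + \<i> * of_real (pi / 2)" .
  have cs: "csqrt (complex_of_real (c2\<^sup>2 - 4 * c1 - 4)) = of_real k"
    using assms(1) by (simp add: csqrt_of_real_nonneg k_def)
  have zz: "complex_of_real N / (of_real s * of_real k) = of_real z"
    by (simp add: z_def)
  have "of_real c2 / of_real k * artanh (complex_of_real z) =
      \<i> * of_real (pi * c2 / (2 * k)) + of_real (c2 / k * artanh z)"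
    unfolding at using k by (simp add: field_simps)
  then show ?thesis
    using assms(1) A
    unfolding phi_complex_def phi_def Let_def cs w_def[symmetric] N_def[symmetric]
      k_def[symmetric] zz z_def[symmetric]
    by (simp add: csqrt_of_real_nonneg exp_add flip: exp_of_real)
qed

end

(* Writing A for the radicand and w = sqrt (r^2 - s^2), logarithmic differentiation gives
   phi_r = r phi / A and phi_s = (c1 s + c2 w) phi / A, from which P and Q follow by algebra.
   A regular extension psi satisfies A (psi - s psi_s) = r^2 psi and
   w A^2 psi_ss = r^2 psi (c1 w - c2 s); the first identity shows that A has no zero for 0 < s <= r,
   and the second one fails at s = r unless c2 = 0.
   With Y the component of y orthogonal to x, the spray is a quadratic polynomial in y plus
   c2 / (|x| (c1 + 1)) |Y| Y. The third derivatives of |Y| Y are orthogonal to x and to Y, hence to the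
   gradient of F, which is a combination of x and y; but they do not vanish in dimension at least 3. *)

theory Submission
  imports Defs
begin

section \<open>Partial derivatives of functions of two variables\<close>

text \<open>The exponent of \<open>phi\<close> is a primitive: as a function of q = (c2 s + 2 w) / s
  its derivative is c2 / (Delta - q^2), with Delta the discriminant, and s^2 (Delta - q^2) = -4 A.
  Both signs of Delta therefore lead to the same derivatives, which are \<open>phi\<close> times
  rational functions of r, s and w. The value c1 = -1 is excluded since it makes the fundamental
  tensor degenerate: phi - s phi_s + (r^2 - s^2) phi_ss equals r^4 (c1 + 1) phi / A^2. Orthogonality
  of the third derivatives of |Y| Y to Y has a structural reason: |Y| Y is the gradient of |Y|^3 / 3
  on the complement of x, whose third derivatives are homogeneous of degree 0, so by Euler's
  identity the fourth ones annihilate Y. The dimension matters because for n = 2 that complement is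
  a line, where |Y| Y is quadratic on each side of 0; from n = 3 on there is a direction orthogonal
  to both x and Y in which the third derivative survives.\<close>

definition has_partials :: "(real \<times> real \<Rightarrow> real) \<Rightarrow> real \<Rightarrow> real \<Rightarrow> real \<times> real \<Rightarrow> bool" where
  "has_partials f a b x \<longleftrightarrow> (f has_derivative (\<lambda>h. fst h * a + snd h * b)) (at x)"

lemma has_partials_const: "has_partials (\<lambda>_. c) 0 0 x"
  unfolding has_partials_def by simp

lemma has_partials_fst: "has_partials fst 1 0 x"
  unfolding has_partials_def by (auto intro!: derivative_eq_intros)

lemma has_partials_snd: "has_partials snd 0 1 x"
  unfolding has_partials_def by (auto intro!: derivative_eq_intros)

lemma has_partials_add:
  assumes "has_partials f a b x" and "has_partials g a' b' x"
  shows "has_partials (\<lambda>x. f x + g x) (a + a') (b + b') x"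
  using assms unfolding has_partials_def
  by (auto intro!: derivative_eq_intros simp: algebra_simps)

lemma has_partials_mult:
  assumes "has_partials f a b x" and "has_partials g a' b' x"
  shows "has_partials (\<lambda>x. f x * g x) (a * g x + f x * a') (b * g x + f x * b') x"
  using assms unfolding has_partials_def
  by (auto intro!: derivative_eq_intros simp: algebra_simps)

lemma has_partials_compose:
  assumes "has_partials f a b x" and "(g has_real_derivative d) (at (f x))"
  shows "has_partials (\<lambda>x. g (f x)) (d * a) (d * b) x"
  using DERIV_compose_FDERIV[OF assms(2) assms(1)[unfolded has_partials_def]]
  unfolding has_partials_def by (simp add: algebra_simps)

lemma has_partials_eq:
  assumes "has_partials f a b x" and "a = a'" and "b = b'"
  shows "has_partials f a' b' x"
  using assms by simp

lemma has_partials_DERIV_fst: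
  assumes "has_partials f a b (r, s)"
  shows "((\<lambda>r. f (r, s)) has_real_derivative a) (at r)"
proof -
  have "((\<lambda>r. (r, s)) has_derivative (\<lambda>h. (h, 0))) (at r)"
    by (auto intro!: derivative_eq_intros)
  from diff_chain_at[OF this assms[unfolded has_partials_def]] show ?thesis
    by (simp add: has_field_derivative_def o_def mult_commute_abs)
qed

lemma has_partials_DERIV_snd:
  assumes "has_partials f a b (r, s)"
  shows "((\<lambda>s. f (r, s)) has_real_derivative b) (at s)"
proof -
  have "((\<lambda>s. (r, s)) has_derivative (\<lambda>h. (0, h))) (at s)"
    by (auto intro!: derivative_eq_intros)
  from diff_chain_at[OF this assms[unfolded has_partials_def]] show ?thesis
    by (simp add: has_field_derivative_def o_def mult_commute_abs)
qed

lemma has_partials_cong_open: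
  assumes "has_partials f a b x" and "open S" "x \<in> S" and "\<And>x. x \<in> S \<Longrightarrow> f x = g x"
  shows "has_partials g a b x"
  using has_derivative_transform_within_open[OF assms(1)[unfolded has_partials_def] assms(2-4)]
  unfolding has_partials_def by auto

text \<open>\<open>deriv\<close> carries no information unless a derivative is known to exist, so
  \<open>d_r\<close> is read off from a total derivative of some g that agrees with f near the
  point. Agreement on an open set suffices, which matters for second derivatives: \<open>d_s\<close>
  of \<open>phi\<close> has its closed form only on the domain.\<close>

lemma d_r_eq_partial:
  assumes "has_partials g a b (r, s)" and "open S" "(r, s) \<in> S"
    and "\<And>r s. (r, s) \<in> S \<Longrightarrow> f r s = g (r, s)"
  shows "d_r f r s = a"
proof -
  have "has_partials (\<lambda>x. f (fst x) (snd x)) a b (r, s)"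
    by (rule has_partials_cong_open[OF assms(1-3)]) (use assms(4) in auto)
  from has_partials_DERIV_fst[OF this] show ?thesis
    by (simp add: d_r_def DERIV_imp_deriv)
qed

lemma d_s_eq_partial:
  assumes "has_partials g a b (r, s)" and "open S" "(r, s) \<in> S"
    and "\<And>r s. (r, s) \<in> S \<Longrightarrow> f r s = g (r, s)"
  shows "d_s f r s = b"
proof -
  have "has_partials (\<lambda>x. f (fst x) (snd x)) a b (r, s)"
    by (rule has_partials_cong_open[OF assms(1-3)]) (use assms(4) in auto)
  from has_partials_DERIV_snd[OF this] show ?thesis
    by (simp add: d_s_def DERIV_imp_deriv)
qed

section \<open>Smoothness from closure under differentiation\<close>

lemma Ck_on_cong:
  assumes "open S" and "\<And>x. x \<in> S \<Longrightarrow> f x = g x" and "Ck_on k S f"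
  shows "Ck_on k S g"
  using assms(2,3)
proof (induction k arbitrary: f g)
  case 0
  then show ?case using continuous_on_cong[of S S f g] by simp
next
  case (Suc k)
  have diff: "g differentiable (at x)" if "x \<in> S" for x
    using Suc.prems that assms(1)
    by (meson Ck_on.simps(2) differentiable_def has_derivative_transform_within_open)
  have fd: "frechet_derivative f (at x) = frechet_derivative g (at x)" if "x \<in> S" for x
  proof -
    have "(f has_derivative frechet_derivative f (at x)) (at x)"
      using Suc.prems(2) that frechet_derivative_works by auto
    then have "(g has_derivative frechet_derivative f (at x)) (at x)"
      by (rule has_derivative_transform_within_open[OF _ assms(1) that Suc.prems(1)])
    then show ?thesis by (rule frechet_derivative_at)
  qed
  show ?case
    using Suc.IH[of "\<lambda>x. frechet_derivative f (at x) v" "\<lambda>x. frechet_derivative g (at x) v" for v]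
      fd Suc.prems(2) diff by auto
qed

text \<open>No derivative of high order is computed: one induction on the order treats all members
  of K together. Linear combinations must stay in K because the derivative in direction v is
  \<open>fst v * f1 x + snd v * f2 x\<close>.\<close>

lemma smooth_on_partials_closed:
  assumes "open S" and "f \<in> K"
    and partials: "\<And>f. f \<in> K \<Longrightarrow> \<exists>f1\<in>K. \<exists>f2\<in>K. \<forall>x\<in>S. has_partials f (f1 x) (f2 x) x"
    and lin: "\<And>f g a b. f \<in> K \<Longrightarrow> g \<in> K \<Longrightarrow> (\<lambda>x. a * f x + b * g x) \<in> K"
  shows "smooth_on S f"
proof -
  have "Ck_on k S f" if "f \<in> K" for k f
    using that
  proof (induction k arbitrary: f)
    case 0
    then obtain f1 f2 where "\<forall>x\<in>S. has_partials f (f1 x) (f2 x) x"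
      using partials by blast
    then show ?case
      unfolding has_partials_def
      by (auto intro!: continuous_at_imp_continuous_on has_derivative_continuous)
  next
    case (Suc k)
    then obtain f1 f2 where f12: "f1 \<in> K" "f2 \<in> K"
      and p: "\<And>x. x \<in> S \<Longrightarrow> has_partials f (f1 x) (f2 x) x"
      using partials by blast
    have "Ck_on k S (\<lambda>x. frechet_derivative f (at x) v)" for v
    proof (rule Ck_on_cong[OF assms(1)])
      show "Ck_on k S (\<lambda>x. fst v * f1 x + snd v * f2 x)"
        by (rule Suc.IH[OF lin[OF f12]])
      show "fst v * f1 x + snd v * f2 x = frechet_derivative f (at x) v" if "x \<in> S" for x
        using frechet_derivative_at[OF p[OF that, unfolded has_partials_def]] by metis
    qed
    moreover have "f differentiable (at x)" if "x \<in> S" for x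
      using p[OF that] unfolding has_partials_def differentiable_def by blast
    ultimately show ?case by simp
  qed
  then show ?thesis using assms(1,2) by (simp add: smooth_on_def)
qed

section \<open>Derivatives of the metric function\<close>

text \<open>The real \<open>ln\<close> is even, so the logarithmic derivative is also correct at
  negative arguments. Such arguments do occur: on the domain the argument of \<open>artanh\<close>
  has absolute value above 1, which makes the quotient inside the logarithm negative.\<close>

lemma DERIV_ln_nonzero:
  assumes "(f has_real_derivative d) (at x)" and "f x \<noteq> 0" and "d / f x = D"
  shows "((\<lambda>x. ln (f x)) has_real_derivative D) (at x)"
proof (cases "f x > 0")
  case True
  then show ?thesis using assms by (auto intro!: derivative_eq_intros)
next
  case False
  have "((\<lambda>x. ln (- f x)) has_real_derivative D) (at x)"
    using assms False by (auto intro!: derivative_eq_intros)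
  then show ?thesis by (simp add: ln_minus)
qed

text \<open>This removes the case distinction on the sign of the discriminant. Afterwards the
  exponent is known only through its derivative, so neither \<open>artanh\<close> nor
  \<open>arctan\<close> has to be unfolded again. The bound on q keeps away from the poles of that
  derivative.\<close>

lemma phi_eq_exponent:
  assumes "c2\<^sup>2 - 4 * c1 - 4 \<noteq> 0"
  obtains e where
    "\<And>r s. phi c1 c2 r s =
       sqrt (radicand c1 c2 r s) * exp (e ((c2 * s + 2 * sqrt (r\<^sup>2 - s\<^sup>2)) / s))"
    and "\<And>q. q\<^sup>2 > c2\<^sup>2 - 4 * c1 - 4 \<Longrightarrow>
       (e has_real_derivative c2 / (c2\<^sup>2 - 4 * c1 - 4 - q\<^sup>2)) (at q)"
proof (cases "c2\<^sup>2 - 4 * c1 - 4 > 0")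
  case True
  define k where "k = sqrt (c2\<^sup>2 - 4 * c1 - 4)"
  have k: "k > 0" "k\<^sup>2 = c2\<^sup>2 - 4 * c1 - 4" using True by (auto simp: k_def)
  define e where "e = (\<lambda>q. c2 / k * (ln ((1 + q / k) / (1 - q / k)) / 2))"
  show ?thesis
  proof (rule that[of e])
    fix r s
    show "phi c1 c2 r s =
       sqrt (radicand c1 c2 r s) * exp (e ((c2 * s + 2 * sqrt (r\<^sup>2 - s\<^sup>2)) / s))"
      using True by (simp add: phi_def e_def artanh_def k_def Let_def)
  next
    fix q :: real assume q: "q\<^sup>2 > c2\<^sup>2 - 4 * c1 - 4"
    then have "q\<^sup>2 - k\<^sup>2 \<noteq> 0" using k by simp
    then have nz: "k - q \<noteq> 0" "k + q \<noteq> 0"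
      by (auto simp: algebra_simps power2_eq_square add_eq_0_iff)
    have eq: "e = (\<lambda>q. c2 / k * (ln ((k + q) / (k - q)) / 2))"
      using k by (simp add: e_def divide_simps)
    have "((\<lambda>q. c2 / k * (ln ((k + q) / (k - q)) / 2)) has_real_derivative
            c2 / (k\<^sup>2 - q\<^sup>2)) (at q)"
      using nz k(1) \<open>q\<^sup>2 - k\<^sup>2 \<noteq> 0\<close>
      by (auto intro!: derivative_eq_intros DERIV_ln_nonzero
          simp: divide_simps) (simp add: algebra_simps power2_eq_square)
    then show "(e has_real_derivative c2 / (c2\<^sup>2 - 4 * c1 - 4 - q\<^sup>2)) (at q)"
      by (simp only: eq k)
  qed
next
  case False
  define k where "k = sqrt (- (c2\<^sup>2 - 4 * c1 - 4))"
  have k: "k > 0" "- (k\<^sup>2) = c2\<^sup>2 - 4 * c1 - 4" using False assms by (auto simp: k_def)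
  define e where "e = (\<lambda>q. - (c2 / k) * arctan (q / k))"
  show ?thesis
  proof (rule that[of e])
    fix r s
    show "phi c1 c2 r s =
       sqrt (radicand c1 c2 r s) * exp (e ((c2 * s + 2 * sqrt (r\<^sup>2 - s\<^sup>2)) / s))"
      using False by (simp add: phi_def e_def k_def Let_def)
  next
    fix q :: real
    have "- (k\<^sup>2) - q\<^sup>2 < 0"
      using k(1) by (smt (verit) zero_less_power2 zero_le_power2)
    moreover have "k\<^sup>2 + q\<^sup>2 > 0" using calculation by simp
    moreover have "1 + (q / k)\<^sup>2 = (k\<^sup>2 + q\<^sup>2) / k\<^sup>2"
      using k(1) by (simp add: field_simps)
    ultimately have "- (c2 / k) * (inverse (1 + (q / k)\<^sup>2) * (1 / k)) = c2 / (- (k\<^sup>2) - q\<^sup>2)"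
      using k(1) by (simp add: divide_simps power2_eq_square) (simp add: algebra_simps)
    moreover have "(e has_real_derivative - (c2 / k) * (inverse (1 + (q / k)\<^sup>2) * (1 / k))) (at q)"
      using k(1) unfolding e_def
      by (auto intro!: derivative_eq_intros)
    ultimately have "(e has_real_derivative c2 / (- (k\<^sup>2) - q\<^sup>2)) (at q)"
      by simp
    then show "(e has_real_derivative c2 / (c2\<^sup>2 - 4 * c1 - 4 - q\<^sup>2)) (at q)"
      by (simp only: k)
  qed
qed

lemma phi_domain_root:
  assumes "(r, s) \<in> phi_domain r0 c1 c2"
  shows "r > 0" and "sqrt (r\<^sup>2 - s\<^sup>2) > 0" and "(sqrt (r\<^sup>2 - s\<^sup>2))\<^sup>2 = r\<^sup>2 - s\<^sup>2"
proof -
  have "\<bar>s\<bar> < r" using assms by (simp add: phi_domain_def)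
  then have "s\<^sup>2 < r\<^sup>2"
    by (metis abs_ge_zero power2_abs power_strict_mono zero_less_numeral)
  with \<open>\<bar>s\<bar> < r\<close> show "r > 0" "sqrt (r\<^sup>2 - s\<^sup>2) > 0" "(sqrt (r\<^sup>2 - s\<^sup>2))\<^sup>2 = r\<^sup>2 - s\<^sup>2"
    by auto
qed

lemma open_phi_domain: "open (phi_domain r0 c1 c2)"
proof -
  have "phi_domain r0 c1 c2 = {x. snd x \<noteq> 0} \<inter> {x. \<bar>snd x\<bar> < fst x} \<inter> {x. fst x < r0} \<inter>
      {x. 0 < radicand c1 c2 (fst x) (snd x)}"
    by (auto simp: phi_domain_def)
  then show ?thesis
    unfolding radicand_def
    by (auto intro!: open_Int open_Collect_less open_Collect_neq continuous_intros)
qed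

lemma has_partials_inverse:
  assumes "has_partials f a b x" and "f x \<noteq> 0"
  shows "has_partials (\<lambda>x. inverse (f x)) (- a / (f x)\<^sup>2) (- b / (f x)\<^sup>2) x"
  by (rule has_partials_eq[OF has_partials_compose[OF assms(1) DERIV_inverse[OF assms(2)]]])
    (auto simp: field_simps power2_eq_square)

text \<open>Logarithmic differentiation, with f'/(2 f) + g' brought over the denominator f. In the
  application f is the radicand, and the derivatives of the exponent have the same
  denominator.\<close>

lemma has_partials_sqrt_exp:
  assumes "has_partials f a b x" and "has_partials g a' b' x" and "f x > 0"
  shows "has_partials (\<lambda>x. sqrt (f x) * exp (g x))
    ((a / 2 + f x * a') * (sqrt (f x) * exp (g x)) / f x)
    ((b / 2 + f x * b') * (sqrt (f x) * exp (g x)) / f x) x"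
proof -
  have R: "sqrt (f x) > 0" "f x = (sqrt (f x))\<^sup>2" using assms(3) by auto
  have eq: "inverse (sqrt (f x)) / 2 * c * exp (g x) + sqrt (f x) * (exp (g x) * c')
      = (c / 2 + f x * c') * (sqrt (f x) * exp (g x)) / f x" for c c'
    \<comment> \<open>Only the two occurrences of \<open>f x\<close> outside a root become squares
      of the root; the identity is then rational in \<open>sqrt (f x)\<close>.\<close>
    by (subst (3 5) R(2)) (use R(1) in \<open>simp add: field_simps power2_eq_square\<close>)
  show ?thesis
    by (rule has_partials_eq[OF has_partials_mult[OF
          has_partials_compose[OF assms(1) DERIV_real_sqrt[OF assms(3)]]
          has_partials_compose[OF assms(2) DERIV_exp]] eq eq])
qed

lemma has_partials_root:
  assumes "(r, s) \<in> phi_domain r0 c1 c2"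
  defines "w \<equiv> sqrt (r\<^sup>2 - s\<^sup>2)"
  shows "has_partials (\<lambda>x. sqrt ((fst x)\<^sup>2 - (snd x)\<^sup>2)) (r / w) (- s / w) (r, s)"
proof -
  note w = phi_domain_root[OF assms(1), folded w_def]
  have "has_partials (\<lambda>x. (fst x)\<^sup>2 - (snd x)\<^sup>2) (2 * r) (- 2 * s) (r, s)"
    unfolding has_partials_def by (auto intro!: derivative_eq_intros)
  then have "has_partials (\<lambda>x. sqrt ((fst x)\<^sup>2 - (snd x)\<^sup>2))
      (inverse w / 2 * (2 * r)) (inverse w / 2 * (- 2 * s)) (r, s)"
    unfolding w_def
    by (rule has_partials_compose) (use w in \<open>auto intro!: DERIV_real_sqrt simp: w_def\<close>)
  then show ?thesis
    by (rule has_partials_eq) (auto simp: field_simps)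
qed

lemma has_partials_radicand:
  assumes "(r, s) \<in> phi_domain r0 c1 c2"
  defines "w \<equiv> sqrt (r\<^sup>2 - s\<^sup>2)"
  shows "has_partials (\<lambda>x. radicand c1 c2 (fst x) (snd x))
    (2 * r + c2 * s * r / w) (2 * c1 * s + c2 * w - c2 * s\<^sup>2 / w) (r, s)"
proof -
  have "has_partials (\<lambda>x. (fst x)\<^sup>2 + c1 * (snd x)\<^sup>2) (2 * r) (2 * c1 * s) (r, s)"
    unfolding has_partials_def by (auto intro!: derivative_eq_intros simp: algebra_simps)
  moreover have "has_partials (\<lambda>x. c2 * snd x) 0 c2 (r, s)"
    unfolding has_partials_def by (auto intro!: derivative_eq_intros simp: algebra_simps)
  ultimately show ?thesis
    unfolding radicand_def
    by (rule has_partials_eq[OF has_partials_add[OF _ has_partials_mult[OF _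
          has_partials_root[OF assms(1), folded w_def]]]])
      (simp_all add: w_def power2_eq_square)
qed

text \<open>The exponent is made to cancel the poles at w = 0. In the r-direction the root of the
  radicand gives c2 s r / (2 w) and the exponent its negative. In the s-direction the poles are - c2
  s^2 / (2 w) and c2 r^2 / (2 w), which add up to c2 w / 2.\<close>

lemma has_partials_phi:
  assumes "c2\<^sup>2 - 4 * c1 - 4 \<noteq> 0" and D: "(r, s) \<in> phi_domain r0 c1 c2"
  defines "w \<equiv> sqrt (r\<^sup>2 - s\<^sup>2)" and "A \<equiv> radicand c1 c2 r s"
  shows "has_partials (\<lambda>x. phi c1 c2 (fst x) (snd x))
    (r * phi c1 c2 r s / A) ((c1 * s + c2 * w) * phi c1 c2 r s / A) (r, s)"
proof -
  note w = phi_domain_root[OF D, folded w_def]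
  have s: "s \<noteq> 0" and A: "A > 0" using D by (auto simp: phi_domain_def A_def)
  have Aw: "A = r\<^sup>2 + c1 * s\<^sup>2 + c2 * s * w" by (simp add: A_def radicand_def w_def)
  obtain e where e:
    "\<And>r s. phi c1 c2 r s =
       sqrt (radicand c1 c2 r s) * exp (e ((c2 * s + 2 * sqrt (r\<^sup>2 - s\<^sup>2)) / s))"
    "\<And>q. q\<^sup>2 > c2\<^sup>2 - 4 * c1 - 4 \<Longrightarrow>
       (e has_real_derivative c2 / (c2\<^sup>2 - 4 * c1 - 4 - q\<^sup>2)) (at q)"
    using phi_eq_exponent[OF assms(1)] by blast
  define q where "q = (c2 * s + 2 * w) / s"
  have qs: "q * s = c2 * s + 2 * w" using s by (simp add: q_def)
  \<comment> \<open>Completing the square: since r^2 = w^2 + s^2, 4 A = (c2 s + 2 w)^2 - (c2^2 - 4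
    c1 - 4) s^2. This is where the discriminant in the metric comes from.\<close>
  have "(c2\<^sup>2 - 4 * c1 - 4 - q\<^sup>2) * s\<^sup>2 = - 4 * A"
    using qs w(3) Aw by algebra
  then have disc: "c2\<^sup>2 - 4 * c1 - 4 - q\<^sup>2 = - 4 * A / s\<^sup>2"
    using s by (simp add: field_simps)
  have hq: "has_partials (\<lambda>x. (c2 * snd x + 2 * sqrt ((fst x)\<^sup>2 - (snd x)\<^sup>2)) / snd x)
      (2 * r / (w * s)) (- 2 * r\<^sup>2 / (w * s\<^sup>2)) (r, s)"
  proof -
    have "has_partials (\<lambda>x. c2 * snd x + 2 * sqrt ((fst x)\<^sup>2 - (snd x)\<^sup>2))
       (2 * r / w) (c2 - 2 * s / w) (r, s)"
      by (rule has_partials_eq[OF has_partials_add[OF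
            has_partials_mult[OF has_partials_const has_partials_snd]
            has_partials_mult[OF has_partials_const has_partials_root[OF D]]]])
        (simp_all add: w_def)
    from has_partials_mult[OF this has_partials_inverse[OF has_partials_snd]] show ?thesis
      unfolding divide_inverse[of _ "snd _"]
    proof (rule has_partials_eq; unfold fst_conv snd_conv w_def[symmetric])
      have "r\<^sup>2 = w\<^sup>2 + s\<^sup>2" using w(3) by simp
      then show "(c2 - 2 * s / w) * inverse s + (c2 * s + 2 * w) * (- 1 / s\<^sup>2)
          = - 2 * r\<^sup>2 / (w * s\<^sup>2)"
        using s w(2) by (simp add: field_simps power2_eq_square)
    qed (use s w(2) in \<open>simp_all add: field_simps\<close>)
  qed
  have "c2\<^sup>2 - 4 * c1 - 4 < q\<^sup>2"
  proof -
    have "- 4 * A / s\<^sup>2 < 0" using A s by (simp add: divide_less_0_iff)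
    then show ?thesis using disc by linarith
  qed
  from e(2)[OF this] have he: "has_partials
      (\<lambda>x. e ((c2 * snd x + 2 * sqrt ((fst x)\<^sup>2 - (snd x)\<^sup>2)) / snd x))
      (c2 / (- 4 * A / s\<^sup>2) * (2 * r / (w * s)))
      (c2 / (- 4 * A / s\<^sup>2) * (- 2 * r\<^sup>2 / (w * s\<^sup>2))) (r, s)"
    unfolding disc by (intro has_partials_compose[OF hq]) (simp add: q_def w_def)
  have "has_partials (\<lambda>x. sqrt (radicand c1 c2 (fst x) (snd x)) *
      exp (e ((c2 * snd x + 2 * sqrt ((fst x)\<^sup>2 - (snd x)\<^sup>2)) / snd x)))
      (((2 * r + c2 * s * r / w) / 2 + A * (c2 / (- 4 * A / s\<^sup>2) * (2 * r / (w * s))))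
         * phi c1 c2 r s / A)
      (((2 * c1 * s + c2 * w - c2 * s\<^sup>2 / w) / 2 +
         A * (c2 / (- 4 * A / s\<^sup>2) * (- 2 * r\<^sup>2 / (w * s\<^sup>2)))) * phi c1 c2 r s / A) (r, s)"
    using has_partials_sqrt_exp[OF has_partials_radicand[OF D, folded w_def] he] A
    unfolding e(1) by (simp add: A_def)
  moreover have "(2 * r + c2 * s * r / w) / 2 + A * (c2 / (- 4 * A / s\<^sup>2) * (2 * r / (w * s))) = r"
    using s w A by (simp add: field_simps power2_eq_square)
  moreover have "(2 * c1 * s + c2 * w - c2 * s\<^sup>2 / w) / 2 +
      A * (c2 / (- 4 * A / s\<^sup>2) * (- 2 * r\<^sup>2 / (w * s\<^sup>2))) = c1 * s + c2 * w"
  proof -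
    have "A * (c2 / (- 4 * A / s\<^sup>2) * (- 2 * r\<^sup>2 / (w * s\<^sup>2))) = c2 * (w\<^sup>2 + s\<^sup>2) / (2 * w)"
      using s w A by (simp add: field_simps)
    then show ?thesis using w(2) by (simp add: field_simps power2_eq_square)
  qed
  ultimately show ?thesis unfolding e(1) by simp
qed

lemma has_partials_phi_s:
  assumes "c2\<^sup>2 - 4 * c1 - 4 \<noteq> 0" and D: "(r, s) \<in> phi_domain r0 c1 c2"
  defines "w \<equiv> sqrt (r\<^sup>2 - s\<^sup>2)" and "A \<equiv> radicand c1 c2 r s"
  shows "has_partials
    (\<lambda>x. (c1 * snd x + c2 * sqrt ((fst x)\<^sup>2 - (snd x)\<^sup>2)) * phi c1 c2 (fst x) (snd x)
       / radicand c1 c2 (fst x) (snd x))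
    (r * phi c1 c2 r s * (c2 * r\<^sup>2 / w - (c1 * s + c2 * w)) / A\<^sup>2)
    (r\<^sup>2 * phi c1 c2 r s * (c1 - c2 * s / w) / A\<^sup>2) (r, s)"
proof -
  note w = phi_domain_root[OF D, folded w_def]
  have A: "A > 0" using D by (auto simp: phi_domain_def A_def)
  have "has_partials (\<lambda>x. c1 * snd x + c2 * sqrt ((fst x)\<^sup>2 - (snd x)\<^sup>2))
      (c2 * r / w) (c1 - c2 * s / w) (r, s)"
    by (rule has_partials_eq[OF has_partials_add[OF
          has_partials_mult[OF has_partials_const has_partials_snd]
          has_partials_mult[OF has_partials_const has_partials_root[OF D]]]])
      (simp_all add: w_def)
  note * = has_partials_mult[OF has_partials_mult[OF this has_partials_phi[OF assms(1) D]]
      has_partials_inverse[OF has_partials_radicand[OF D]]]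
  have quotient: "(x * p + M * (y * p / A)) * inverse A + M * p * (- z / A\<^sup>2)
      = p * (x * A + M * y - M * z) / A\<^sup>2" for x y z p M
    using A by (simp add: field_simps power2_eq_square)
  \<comment> \<open>\<open>M\<close> is A phi_s / phi. Writing A = r^2 + M s makes the numerators of
    the second derivatives collapse.\<close>
  define M where "M = c1 * s + c2 * w"
  have "A = r\<^sup>2 + c1 * s\<^sup>2 + c2 * s * w" by (simp add: A_def radicand_def w_def)
  then have AM: "A = r\<^sup>2 + M * s" by (simp add: M_def algebra_simps power2_eq_square)
  have eq1: "c2 * r / w * A + M * r - M * (2 * r + c2 * s * r / w) = r * (c2 * r\<^sup>2 / w - M)"
    using w(2) unfolding AM by (simp add: field_simps power2_eq_square)
  have eq2: "(c1 - c2 * s / w) * A + M * M - M * (2 * c1 * s + c2 * w - c2 * s\<^sup>2 / w)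
      = r\<^sup>2 * (c1 - c2 * s / w)"
    using w(2) unfolding AM by (simp add: field_simps power2_eq_square M_def)
  show ?thesis
    unfolding divide_inverse[of _ "radicand _ _ _ _"]
    by (rule has_partials_eq[OF *];
        unfold fst_conv snd_conv w_def[symmetric] A_def[symmetric] M_def[symmetric] quotient eq1 eq2)
      (use A in \<open>simp_all add: mult_ac\<close>)
qed

lemma phi_pos: "(r, s) \<in> phi_domain r0 c1 c2 \<Longrightarrow> phi c1 c2 r s > 0"
  by (simp add: phi_domain_def phi_def Let_def)

lemma phi_partial_derivatives:
  assumes \<Delta>: "c2\<^sup>2 - 4 * c1 - 4 \<noteq> 0" and D: "(r, s) \<in> phi_domain r0 c1 c2"
  defines "w \<equiv> sqrt (r\<^sup>2 - s\<^sup>2)" and "A \<equiv> radicand c1 c2 r s"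
  shows "d_r (phi c1 c2) r s = r * phi c1 c2 r s / A"
    and "d_s (phi c1 c2) r s = (c1 * s + c2 * w) * phi c1 c2 r s / A"
    and "d_r (d_s (phi c1 c2)) r s
      = r * phi c1 c2 r s * (c2 * r\<^sup>2 / w - (c1 * s + c2 * w)) / A\<^sup>2"
    and "d_s (d_s (phi c1 c2)) r s = r\<^sup>2 * phi c1 c2 r s * (c1 - c2 * s / w) / A\<^sup>2"
proof -
  have d_s: "d_s (phi c1 c2) r s
      = (c1 * s + c2 * sqrt (r\<^sup>2 - s\<^sup>2)) * phi c1 c2 r s / radicand c1 c2 r s"
    if "(r, s) \<in> phi_domain r0 c1 c2" for r s
    by (rule d_s_eq_partial[OF has_partials_phi[OF \<Delta> that] open_phi_domain that]) simp
  show "d_s (phi c1 c2) r s = (c1 * s + c2 * w) * phi c1 c2 r s / A"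
    unfolding w_def A_def by (rule d_s[OF D])
  show "d_r (phi c1 c2) r s = r * phi c1 c2 r s / A"
    unfolding A_def
    by (rule d_r_eq_partial[OF has_partials_phi[OF \<Delta> D] open_phi_domain D]) simp
  show "d_r (d_s (phi c1 c2)) r s
      = r * phi c1 c2 r s * (c2 * r\<^sup>2 / w - (c1 * s + c2 * w)) / A\<^sup>2"
    unfolding A_def w_def
    by (rule d_r_eq_partial[OF has_partials_phi_s[OF \<Delta> D] open_phi_domain D]) (simp add: d_s)
  show "d_s (d_s (phi c1 c2)) r s = r\<^sup>2 * phi c1 c2 r s * (c1 - c2 * s / w) / A\<^sup>2"
    unfolding A_def w_def
    by (rule d_s_eq_partial[OF has_partials_phi_s[OF \<Delta> D] open_phi_domain D]) (simp add: d_s)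
qed

section \<open>Nondegeneracy and the spray coefficients\<close>

lemma radicand_eq:
  "radicand c1 c2 r s = r\<^sup>2 + (c1 * s + c2 * sqrt (r\<^sup>2 - s\<^sup>2)) * s"
  by (simp add: radicand_def algebra_simps power2_eq_square)

text \<open>With M = c1 s + c2 w the first identity is A - s M = r^2. For the second, w (c1 w - c2
  s) = (c1 + 1) r^2 - A, so adding w^2 phi_ss cancels the summand r^2 phi / A and leaves a multiple
  of c1 + 1.\<close>

lemma phi_regularity_terms:
  assumes \<Delta>: "c2\<^sup>2 - 4 * c1 - 4 \<noteq> 0" and D: "(r, s) \<in> phi_domain r0 c1 c2"
  defines "A \<equiv> radicand c1 c2 r s"
  shows "phi c1 c2 r s - s * d_s (phi c1 c2) r s = r\<^sup>2 * phi c1 c2 r s / A"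
    and "phi c1 c2 r s - s * d_s (phi c1 c2) r s + (r\<^sup>2 - s\<^sup>2) * d_s (d_s (phi c1 c2)) r s
      = r^4 * (c1 + 1) * phi c1 c2 r s / A\<^sup>2"
proof -
  define w where "w = sqrt (r\<^sup>2 - s\<^sup>2)"
  define p where "p = phi c1 c2 r s"
  note w = phi_domain_root[OF D, folded w_def]
  note pd = phi_partial_derivatives[OF \<Delta> D, folded w_def A_def p_def]
  have A: "A > 0" using D by (auto simp: phi_domain_def A_def)
  have AM: "A = r\<^sup>2 + (c1 * s + c2 * w) * s" by (simp add: A_def w_def radicand_eq)
  have "p - s * ((c1 * s + c2 * w) * p / A) = (A - (c1 * s + c2 * w) * s) * p / A"
    using A by (simp add: field_simps)
  then have 1: "p - s * ((c1 * s + c2 * w) * p / A) = r\<^sup>2 * p / A"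
    by (simp add: AM)
  then show "phi c1 c2 r s - s * d_s (phi c1 c2) r s = r\<^sup>2 * phi c1 c2 r s / A"
    by (simp add: pd flip: p_def)
  have "w * (c1 * w - c2 * s) = (c1 + 1) * r\<^sup>2 - A"
    unfolding AM using w(3) by algebra
  moreover have "w\<^sup>2 * (c1 - c2 * s / w) = w * (c1 * w - c2 * s)"
    using w(2) by (simp add: field_simps power2_eq_square)
  ultimately have "w\<^sup>2 * (r\<^sup>2 * p * (c1 - c2 * s / w) / A\<^sup>2)
      = r\<^sup>2 * p * ((c1 + 1) * r\<^sup>2 - A) / A\<^sup>2"
    by (metis (no_types, lifting) mult.left_commute times_divide_eq_right)
  then show "phi c1 c2 r s - s * d_s (phi c1 c2) r s + (r\<^sup>2 - s\<^sup>2) * d_s (d_s (phi c1 c2)) r s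
      = r^4 * (c1 + 1) * phi c1 c2 r s / A\<^sup>2"
    unfolding w(3)[symmetric] pd p_def[symmetric] 1
    using A by (simp add: field_simps power2_eq_square power4_eq_xxxx)
qed

text \<open>Numerator and denominator share the factor phi / A^2, so \<open>phi\<close> drops out of
  the quotient. The terms with 1/w in the numerator cancel, as s phi_rs and r phi_ss contribute them
  with opposite signs.\<close>

lemma spray_Q_phi:
  assumes \<Delta>: "c2\<^sup>2 - 4 * c1 - 4 \<noteq> 0" and "c1 \<noteq> -1" and D: "(r, s) \<in> phi_domain r0 c1 c2"
  shows "spray_Q (phi c1 c2) r s = (c1 - 1) / (2 * r\<^sup>2 * (c1 + 1))
    - c1 * s\<^sup>2 / (r^4 * (c1 + 1)) - c2 * s * sqrt (r\<^sup>2 - s\<^sup>2) / (r^4 * (c1 + 1))"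
proof -
  define w where "w = sqrt (r\<^sup>2 - s\<^sup>2)"
  define p where "p = phi c1 c2 r s"
  define A where "A = radicand c1 c2 r s"
  define M where "M = c1 * s + c2 * w"
  note pd = phi_partial_derivatives[OF \<Delta> D, folded w_def A_def p_def M_def]
  note w = phi_domain_root[OF D, folded w_def]
  have p: "p > 0" unfolding p_def by (rule phi_pos[OF D])
  have A: "A > 0" using D by (auto simp: phi_domain_def A_def)
  have AM: "A = r\<^sup>2 + M * s" by (simp add: A_def w_def M_def radicand_eq)
  have c: "c1 + 1 \<noteq> 0" using assms(2) by (simp add: add_eq_0_iff)
  have "- (r * p / A) + s * (r * p * (c2 * r\<^sup>2 / w - M) / A\<^sup>2) + r * (r\<^sup>2 * p * (c1 - c2 * s / w) / A\<^sup>2)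
      = r * p * (- A + s * (c2 * r\<^sup>2 / w - M) + r\<^sup>2 * (c1 - c2 * s / w)) / A\<^sup>2"
    using A by (simp add: field_simps power2_eq_square)
  also have "- A + s * (c2 * r\<^sup>2 / w - M) + r\<^sup>2 * (c1 - c2 * s / w) = r\<^sup>2 * (c1 - 1) - 2 * s * M"
    using w(2) unfolding AM by (simp add: field_simps)
  finally have num: "- (r * p / A) + s * (r * p * (c2 * r\<^sup>2 / w - M) / A\<^sup>2)
      + r * (r\<^sup>2 * p * (c1 - c2 * s / w) / A\<^sup>2) = r * p * (r\<^sup>2 * (c1 - 1) - 2 * s * M) / A\<^sup>2" .
  have "spray_Q (phi c1 c2) r s = 1 / (2 * r) *
      (r * p * (r\<^sup>2 * (c1 - 1) - 2 * s * M) / A\<^sup>2 / (r^4 * (c1 + 1) * p / A\<^sup>2))"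
    unfolding spray_Q_def
    by (subst phi_regularity_terms(2)[OF \<Delta> D]) (simp only: pd num flip: A_def p_def)
  also have "\<dots> = (r\<^sup>2 * (c1 - 1) - 2 * s * M) / (2 * r^4 * (c1 + 1))"
    using A p w(1) by simp
  also have "\<dots> = (c1 - 1) / (2 * r\<^sup>2 * (c1 + 1)) - c1 * s\<^sup>2 / (r^4 * (c1 + 1))
      - c2 * s * w / (r^4 * (c1 + 1))"
  proof -
    have "(r\<^sup>2 * k - 2 * s * (x + y)) / (2 * r^4 * d)
        = k / (2 * r\<^sup>2 * d) - s * x / (r^4 * d) - y * s / (r^4 * d)" if "d \<noteq> 0" for k x y d
      using w(1) that by (simp add: field_simps power4_eq_xxxx power2_eq_square)
    from this[OF c, of "c1 - 1" "c1 * s" "c2 * w"] show ?thesis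
      by (simp add: M_def power2_eq_square mult_ac)
  qed
  finally show ?thesis by (simp add: w_def)
qed

text \<open>Two facts remove A from the result: both summands of P contain the factor s + M over A,
  and 1 - 2 Q r^2 is itself a multiple of A.\<close>

lemma spray_P_phi:
  assumes \<Delta>: "c2\<^sup>2 - 4 * c1 - 4 \<noteq> 0" and "c1 \<noteq> -1" and D: "(r, s) \<in> phi_domain r0 c1 c2"
  shows "spray_P (phi c1 c2) r s = s / r\<^sup>2 + c2 * sqrt (r\<^sup>2 - s\<^sup>2) / (r\<^sup>2 * (c1 + 1))"
proof -
  define w where "w = sqrt (r\<^sup>2 - s\<^sup>2)"
  define p where "p = phi c1 c2 r s"
  define A where "A = radicand c1 c2 r s"
  define M where "M = c1 * s + c2 * w"
  note pd = phi_partial_derivatives[OF \<Delta> D, folded w_def A_def p_def M_def]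
  define Q where "Q = spray_Q (phi c1 c2) r s"
  note w = phi_domain_root[OF D, folded w_def]
  have p: "p > 0" unfolding p_def by (rule phi_pos[OF D])
  have A: "A > 0" using D by (auto simp: phi_domain_def A_def)
  have AM: "A = r\<^sup>2 + M * s" by (simp add: A_def w_def M_def radicand_eq)
  have c: "c1 + 1 \<noteq> 0" using assms(2) by (simp add: add_eq_0_iff)
  have Q_eq: "Q = (c1 - 1) / (2 * r\<^sup>2 * (c1 + 1)) - c1 * s\<^sup>2 / (r^4 * (c1 + 1))
      - c2 * s * w / (r^4 * (c1 + 1))"
    unfolding Q_def w_def by (rule spray_Q_phi[OF assms])
  have Q: "1 - 2 * Q * r\<^sup>2 = 2 * A / (r\<^sup>2 * (c1 + 1))"
    unfolding Q_eq AM M_def using w(1) c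
    by (simp add: divide_simps) (simp add: algebra_simps power2_eq_square power4_eq_xxxx)
  have e1: "s + w\<^sup>2 * M / A = r\<^sup>2 * (s + M) / A"
    unfolding w(3) using A by (simp add: field_simps) (simp add: AM algebra_simps power2_eq_square)
  have "spray_P (phi c1 c2) r s =
      - (Q / p) * (s * p + w\<^sup>2 * (M * p / A)) + 1 / (2 * r * p) * (s * (r * p / A) + r * (M * p / A))"
    by (simp only: spray_P_def pd w(3) flip: Q_def p_def)
  also have "\<dots> = - Q * (s + w\<^sup>2 * M / A) + (s + M) / (2 * A)"
    using A p w(1) by (simp add: field_simps)
  also have "\<dots> = (s + M) / (2 * A) * (1 - 2 * Q * r\<^sup>2)"
    unfolding e1 using A by (simp add: field_simps)
  also have "\<dots> = (s + M) / (r\<^sup>2 * (c1 + 1))"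
    unfolding Q using A by simp
  also have "\<dots> = s / r\<^sup>2 + c2 * w / (r\<^sup>2 * (c1 + 1))"
  proof -
    have "s + M = s * (c1 + 1) + c2 * w" by (simp add: M_def algebra_simps)
    then show ?thesis using c by (simp add: add_divide_distrib)
  qed
  finally show ?thesis by (simp add: w_def)
qed

section \<open>Smoothness of the metric function\<close>

text \<open>A family of functions that contains \<open>\<phi>\<close> and is closed under partial differentiation,
  which makes all of its members smooth.\<close>

inductive_set phi_algebra :: "real \<Rightarrow> real \<Rightarrow> (real \<times> real \<Rightarrow> real) set" for c1 c2 where
  const: "(\<lambda>_. c) \<in> phi_algebra c1 c2"
| fst: "fst \<in> phi_algebra c1 c2"
| snd: "snd \<in> phi_algebra c1 c2"
| root: "(\<lambda>x. sqrt ((fst x)\<^sup>2 - (snd x)\<^sup>2)) \<in> phi_algebra c1 c2"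
| inverse_root: "(\<lambda>x. inverse (sqrt ((fst x)\<^sup>2 - (snd x)\<^sup>2))) \<in> phi_algebra c1 c2"
| inverse_radicand: "(\<lambda>x. inverse (radicand c1 c2 (fst x) (snd x))) \<in> phi_algebra c1 c2"
| phi: "(\<lambda>x. phi c1 c2 (fst x) (snd x)) \<in> phi_algebra c1 c2"
| add: "f \<in> phi_algebra c1 c2 \<Longrightarrow> g \<in> phi_algebra c1 c2 \<Longrightarrow> (\<lambda>x. f x + g x) \<in> phi_algebra c1 c2"
| mult: "f \<in> phi_algebra c1 c2 \<Longrightarrow> g \<in> phi_algebra c1 c2 \<Longrightarrow> (\<lambda>x. f x * g x) \<in> phi_algebra c1 c2"

text \<open>The generators are chosen so that differentiation creates no new denominators: the root
  brings in its inverse, \<open>phi\<close> the inverse radicand, and the two inverses powers of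
  themselves. Signs are written as multiplication by the constant -1 in order to match the closure
  rules.\<close>

lemma phi_algebra_partials:
  assumes \<Delta>: "c2\<^sup>2 - 4 * c1 - 4 \<noteq> 0" and "f \<in> phi_algebra c1 c2"
  shows "\<exists>f1\<in>phi_algebra c1 c2. \<exists>f2\<in>phi_algebra c1 c2.
    \<forall>x\<in>phi_domain r0 c1 c2. has_partials f (f1 x) (f2 x) x"
proof -
  let ?w = "\<lambda>x::real \<times> real. sqrt ((fst x)\<^sup>2 - (snd x)\<^sup>2)"
  let ?A = "\<lambda>x::real \<times> real. radicand c1 c2 (fst x) (snd x)"
  let ?p = "\<lambda>x::real \<times> real. phi c1 c2 (fst x) (snd x)"
  let ?D = "phi_domain r0 c1 c2"
  note K = phi_algebra.intros
  have nz: "?w x \<noteq> 0" "?A x \<noteq> 0" if "x \<in> ?D" for x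
    using that phi_domain_root(2)[of "fst x" "snd x" r0 c1 c2] by (auto simp: phi_domain_def)
  note d_root = has_partials_root[of "fst x" "snd x" for x, unfolded prod.collapse]
  note d_rad = has_partials_radicand[of "fst x" "snd x" for x, unfolded prod.collapse]
  note d_phi = has_partials_phi[OF \<Delta>, of "fst x" "snd x" for x, unfolded prod.collapse]
  have I: "\<exists>f1\<in>phi_algebra c1 c2. \<exists>f2\<in>phi_algebra c1 c2. \<forall>x\<in>?D. has_partials f (f1 x) (f2 x) x"
    if "f1 \<in> phi_algebra c1 c2" "f2 \<in> phi_algebra c1 c2"
      "\<And>x. x \<in> ?D \<Longrightarrow> has_partials f (f1 x) (f2 x) x" for f f1 f2
    using that by blast
  show ?thesis
    using assms(2)
  proof induction
    case (const c)
    show ?case by (rule I[OF K(1)[of 0] K(1)[of 0]]) (rule has_partials_const)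
  next
    case fst
    show ?case by (rule I[OF K(1)[of 1] K(1)[of 0]]) (rule has_partials_fst)
  next
    case snd
    show ?case by (rule I[OF K(1)[of 0] K(1)[of 1]]) (rule has_partials_snd)
  next
    case root
    show ?case
    proof (rule I)
      show "(\<lambda>x. fst x * inverse (?w x)) \<in> phi_algebra c1 c2"
        "(\<lambda>x. (-1) * snd x * inverse (?w x)) \<in> phi_algebra c1 c2"
        by (intro K)+
    qed (rule has_partials_eq[OF d_root], assumption, simp_all add: divide_inverse)
  next
    case inverse_root
    show ?case
    proof (rule I)
      show "(\<lambda>x. (-1) * fst x * inverse (?w x) * inverse (?w x) * inverse (?w x)) \<in> phi_algebra c1 c2"
        "(\<lambda>x. snd x * inverse (?w x) * inverse (?w x) * inverse (?w x)) \<in> phi_algebra c1 c2"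
        by (intro K)+
    next
      have cube: "- (a / w) / w\<^sup>2 = (-1) * a * inverse w * inverse w * inverse w"
        "- (- a / w) / w\<^sup>2 = a * inverse w * inverse w * inverse w" for a w :: real
        by (simp_all add: divide_inverse power2_eq_square mult_ac)
      show "has_partials (\<lambda>x. inverse (?w x))
          ((-1) * fst x * inverse (?w x) * inverse (?w x) * inverse (?w x))
          (snd x * inverse (?w x) * inverse (?w x) * inverse (?w x)) x"
        if "x \<in> ?D" for x
        by (rule has_partials_eq[OF has_partials_inverse[OF d_root[OF that] nz(1)[OF that]] cube])
    qed
  next
    case inverse_radicand
    show ?case
    proof (rule I)
      show "(\<lambda>x. (-1) * (2 * fst x + c2 * snd x * fst x * inverse (?w x)) *
              inverse (?A x) * inverse (?A x)) \<in> phi_algebra c1 c2"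
        "(\<lambda>x. (-1) * (2 * c1 * snd x + c2 * ?w x + (-1) * c2 * (snd x * snd x) * inverse (?w x)) *
              inverse (?A x) * inverse (?A x)) \<in> phi_algebra c1 c2"
        by (intro K)+
    qed (rule has_partials_eq[OF has_partials_inverse[OF d_rad]],
        use nz in \<open>simp_all add: divide_inverse power2_eq_square\<close>)
  next
    case phi
    show ?case
    proof (rule I)
      show "(\<lambda>x. fst x * ?p x * inverse (?A x)) \<in> phi_algebra c1 c2"
        "(\<lambda>x. (c1 * snd x + c2 * ?w x) * ?p x * inverse (?A x)) \<in> phi_algebra c1 c2"
        by (intro K)+
    qed (rule has_partials_eq[OF d_phi], assumption, simp_all add: divide_inverse mult.assoc)
  next
    case (add f g)
    then obtain f1 f2 g1 g2 where *: "f1 \<in> phi_algebra c1 c2" "f2 \<in> phi_algebra c1 c2"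
      "g1 \<in> phi_algebra c1 c2" "g2 \<in> phi_algebra c1 c2"
      and p: "\<forall>x\<in>?D. has_partials f (f1 x) (f2 x) x" "\<forall>x\<in>?D. has_partials g (g1 x) (g2 x) x"
      by blast
    show ?case
    proof (rule I)
      show "(\<lambda>x. f1 x + g1 x) \<in> phi_algebra c1 c2" "(\<lambda>x. f2 x + g2 x) \<in> phi_algebra c1 c2"
        by (intro K(8) *)+
    qed (use p has_partials_add in blast)
  next
    case (mult f g)
    then obtain f1 f2 g1 g2 where *: "f1 \<in> phi_algebra c1 c2" "f2 \<in> phi_algebra c1 c2"
      "g1 \<in> phi_algebra c1 c2" "g2 \<in> phi_algebra c1 c2"
      and p: "\<forall>x\<in>?D. has_partials f (f1 x) (f2 x) x" "\<forall>x\<in>?D. has_partials g (g1 x) (g2 x) x"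
      by blast
    show ?case
    proof (rule I)
      show "(\<lambda>x. f1 x * g x + f x * g1 x) \<in> phi_algebra c1 c2"
        "(\<lambda>x. f2 x * g x + f x * g2 x) \<in> phi_algebra c1 c2"
        by (intro K(8,9) * mult.hyps)+
    qed (use p has_partials_mult in blast)
  qed
qed

lemma smooth_on_phi:
  assumes "c2\<^sup>2 - 4 * c1 - 4 \<noteq> 0"
  shows "smooth_on (phi_domain r0 c1 c2) (\<lambda>(r, s). phi c1 c2 r s)"
  unfolding case_prod_unfold
  by (rule smooth_on_partials_closed[OF open_phi_domain phi_algebra.phi
        phi_algebra_partials[OF assms]])
    (assumption, intro phi_algebra.const phi_algebra.add phi_algebra.mult)

lemma sph_metric_on_phi:
  assumes "c2\<^sup>2 - 4 * c1 - 4 \<noteq> 0" and "c1 \<noteq> -1"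
  shows "sph_metric_on (phi_domain r0 c1 c2) (phi c1 c2)"
proof -
  have "phi c1 c2 r s - s * d_s (phi c1 c2) r s \<noteq> 0"
    and "phi c1 c2 r s - s * d_s (phi c1 c2) r s + (r\<^sup>2 - s\<^sup>2) * d_s (d_s (phi c1 c2)) r s \<noteq> 0"
    if D: "(r, s) \<in> phi_domain r0 c1 c2" for r s
    unfolding phi_regularity_terms(2)[OF assms(1) D]
    unfolding phi_regularity_terms(1)[OF assms(1) D]
    using phi_pos[OF D] phi_domain_root(1)[OF D] assms(2) D
    by (auto simp: phi_domain_def)
  then show ?thesis
    unfolding sph_metric_on_def using smooth_on_phi[OF assms(1)] phi_pos by blast
qed

section \<open>Non-regularity\<close>

lemma differentiable_has_partials:
  assumes "f differentiable (at x)"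
  shows "has_partials f (frechet_derivative f (at x) (1, 0)) (frechet_derivative f (at x) (0, 1)) x"
proof -
  let ?f' = "frechet_derivative f (at x)"
  have f': "(f has_derivative ?f') (at x)"
    using assms frechet_derivative_works by blast
  then interpret linear ?f' by (rule has_derivative_linear)
  have "?f' h = fst h * ?f' (1, 0) + snd h * ?f' (0, 1)" for h
  proof -
    have "?f' h = ?f' (fst h *\<^sub>R (1, 0) + snd h *\<^sub>R (0, 1))" by simp
    then show ?thesis unfolding add scale by simp
  qed
  then have "?f' = (\<lambda>h. fst h * ?f' (1, 0) + snd h * ?f' (0, 1))" by blast
  with f' show ?thesis unfolding has_partials_def by simp
qed

text \<open>\<open>f11\<close> and \<open>f12\<close> are the r- and s-partials of
  \<open>f2\<close>, so \<open>f12\<close> is f_ss. The continuity claims let identities known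
  inside the domain of \<open>phi\<close> pass to its boundary.\<close>

lemma smooth_on_partials:
  assumes "smooth_on U f"
  obtains f1 f2 f11 f12 where
    "\<And>x. x \<in> U \<Longrightarrow> has_partials f (f1 x) (f2 x) x"
    and "\<And>x. x \<in> U \<Longrightarrow> has_partials f2 (f11 x) (f12 x) x"
    and "continuous_on U f" "continuous_on U f2" "continuous_on U f12"
proof -
  have C: "Ck_on k U f" for k using assms by (simp add: smooth_on_def)
  show ?thesis
  proof (rule that)
    show "continuous_on U f" using C[of 0] by simp
    show "has_partials f (frechet_derivative f (at x) (1, 0)) (frechet_derivative f (at x) (0, 1)) x"
      if "x \<in> U" for x
      using C[of "Suc 0"] that by (simp add: differentiable_has_partials)
    let ?g = "\<lambda>x. frechet_derivative f (at x) (0, 1)"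
    show "has_partials ?g (frechet_derivative ?g (at x) (1, 0)) (frechet_derivative ?g (at x) (0, 1)) x"
      if "x \<in> U" for x
      using C[of "Suc (Suc 0)"] that by (simp add: differentiable_has_partials)
    show "continuous_on U ?g" "continuous_on U (\<lambda>x. frechet_derivative ?g (at x) (0, 1))"
      using C[of "Suc 0"] C[of "Suc (Suc 0)"] by auto
  qed
qed

lemma continuous_zero_at_endpoint:
  fixes f :: "real \<Rightarrow> real"
  assumes "continuous_on {0..b} f" and "0 < b" and "\<And>s. 0 < s \<Longrightarrow> s < b \<Longrightarrow> f s = 0"
  shows "f b = 0"
proof -
  have cl: "closure {0<..<b} = {0..b}" using assms(2) by simp
  show ?thesis
    by (rule continuous_constant_on_closure[of "{0<..<b}"]) (use assms cl in auto)
qed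

text \<open>The argument runs along one slice of fixed r, with s going from 0 to r. Both identities
  are cleared of denominators, so they extend by continuity to points where A or w vanishes. Zeros
  of A have to be excluded first, because \<open>psi\<close> is tied to \<open>phi\<close> only
  where A is positive and the point s = r could otherwise be out of reach.\<close>

lemma nonregular_phi:
  assumes \<Delta>: "c2\<^sup>2 - 4 * c1 - 4 \<noteq> 0" and "c2 \<noteq> 0" and "r0 > 0"
  shows "nonregular_sph r0 (phi_domain r0 c1 c2) (phi c1 c2)"
  unfolding nonregular_sph_def
proof (rule notI, elim exE conjE)
  fix \<psi>
  assume reg: "regular_sph r0 \<psi>" and eq: "\<forall>(r, s)\<in>phi_domain r0 c1 c2. \<psi> r s = phi c1 c2 r s"
  obtain U where U: "{(r, s). \<bar>s\<bar> \<le> r \<and> r < r0} \<subseteq> U" "smooth_on U (\<lambda>(r, s). \<psi> r s)"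
    using reg unfolding regular_sph_def by blast
  obtain f1 f2 f11 f12 where
    p1: "\<And>x. x \<in> U \<Longrightarrow> has_partials (\<lambda>(r, s). \<psi> r s) (f1 x) (f2 x) x"
    and p2: "\<And>x. x \<in> U \<Longrightarrow> has_partials f2 (f11 x) (f12 x) x"
    and cont: "continuous_on U (\<lambda>(r, s). \<psi> r s)" "continuous_on U f2" "continuous_on U f12"
    using smooth_on_partials[OF U(2)] by blast
  have oU: "open U" using U(2) by (simp add: smooth_on_def)
  define r where "r = r0 / 2"
  have r: "0 < r" "r < r0" using assms(3) by (auto simp: r_def)
  have inU: "(r, s) \<in> U" if "\<bar>s\<bar> \<le> r" for s using U(1) r that by auto
  define A where "A = radicand c1 c2 r"
  define w where "w = (\<lambda>s. sqrt (r\<^sup>2 - s\<^sup>2))"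
  have contA: "continuous_on X A" and contw: "continuous_on X w" for X
    unfolding A_def w_def radicand_def by (auto intro!: continuous_intros)
  have cont': "continuous_on {0..b} (\<lambda>s. \<psi> r s)" "continuous_on {0..b} (\<lambda>s. f2 (r, s))"
    "continuous_on {0..b} (\<lambda>s. f12 (r, s))" if "b \<le> r" for b
  proof -
    have slice: "continuous_on {0..b} (\<lambda>s. g (r, s))" if "continuous_on U g" for g :: "_ \<Rightarrow> real"
      by (rule continuous_on_compose2[OF that])
        (use inU \<open>b \<le> r\<close> in \<open>auto intro!: continuous_intros\<close>)
    show "continuous_on {0..b} (\<lambda>s. \<psi> r s)" using slice[OF cont(1)] by simp
    show "continuous_on {0..b} (\<lambda>s. f2 (r, s))" "continuous_on {0..b} (\<lambda>s. f12 (r, s))"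
      by (fact slice[OF cont(2)] slice[OF cont(3)])+
  qed
  have onD: "A s * (\<psi> r s - s * f2 (r, s)) = r\<^sup>2 * \<psi> r s"
    "w s * (A s)\<^sup>2 * f12 (r, s) = r\<^sup>2 * \<psi> r s * (c1 * w s - c2 * s)"
    if s: "0 < s" "s < r" "A s > 0" for s
  proof -
    have D: "(r, s) \<in> phi_domain r0 c1 c2"
      using s r by (simp add: phi_domain_def A_def)
    have DU: "phi_domain r0 c1 c2 \<subseteq> U" using U(1) by (auto simp: phi_domain_def)
    \<comment> \<open>Stated on the whole domain and not just on the slice, because the next step
      differentiates this equality.\<close>
    have f2: "d_s (phi c1 c2) r s = f2 (r, s)" if D: "(r, s) \<in> phi_domain r0 c1 c2" for r s
      by (rule d_s_eq_partial[OF p1 open_phi_domain D]) (use D DU eq in auto)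
    have f12: "d_s (d_s (phi c1 c2)) r s = f12 (r, s)"
      by (rule d_s_eq_partial[OF p2 open_phi_domain D]) (use D DU f2 in auto)
    have ps: "\<psi> r s = phi c1 c2 r s" using eq D by auto
    note w = phi_domain_root[OF D]
    show "A s * (\<psi> r s - s * f2 (r, s)) = r\<^sup>2 * \<psi> r s"
      using phi_regularity_terms(1)[OF \<Delta> D] s(3) by (simp add: ps f2 D A_def)
    show "w s * (A s)\<^sup>2 * f12 (r, s) = r\<^sup>2 * \<psi> r s * (c1 * w s - c2 * s)"
      using phi_partial_derivatives(4)[OF \<Delta> D] s(3) w(2)
      by (simp add: ps f12 A_def w_def field_simps)
  qed
  have pos: "\<psi> r s > 0" "\<psi> r s - s * f2 (r, s) > 0" if "\<bar>s\<bar> \<le> r" for s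
  proof -
    have "d_s \<psi> r s = f2 (r, s)"
      by (rule d_s_eq_partial[OF p1 oU]) (use inU[OF that] in auto)
    moreover have "\<psi> r s > 0 \<and> \<psi> r s - s * d_s \<psi> r s > 0"
      using reg that r(2) unfolding regular_sph_def by blast
    ultimately show "\<psi> r s > 0" "\<psi> r s - s * f2 (r, s) > 0" by simp_all
  qed
  \<comment> \<open>At a first zero of the radicand, the first identity of \<open>onD\<close> would force \<open>\<psi> = 0\<close>.\<close>
  have A_pos: "A s > 0" if "0 \<le> s" "s \<le> r" for s
  proof (rule ccontr)
    assume "\<not> A s > 0"
    define Z where "Z = {0..r} \<inter> {s. A s \<le> 0}"
    have "closed {s. A s \<le> 0}"
      using contA by (intro closed_Collect_le continuous_intros) auto
    then have "compact Z" unfolding Z_def by (intro compact_Int_closed) auto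
    moreover have "Z \<noteq> {}" using that \<open>\<not> A s > 0\<close> by (auto simp: Z_def)
    ultimately obtain b where b: "b \<in> Z" "\<And>t. t \<in> Z \<Longrightarrow> b \<le> t"
      using compact_attains_inf[of Z] by blast
    \<comment> \<open>The least point of \<open>Z\<close> thus lies beyond s = 0, which
      \<open>phi_domain\<close> excludes, and \<open>phi\<close> and \<open>psi\<close> agree at all
      s strictly between 0 and that point.\<close>
    have "A 0 > 0" using r by (simp add: A_def radicand_def)
    then have b0: "0 < b" "b \<le> r" "A b \<le> 0" using b(1) by (auto simp: Z_def less_le)
    have "A b * (\<psi> r b - b * f2 (r, b)) - r\<^sup>2 * \<psi> r b = 0"
    proof (rule continuous_zero_at_endpoint[where
          f = "\<lambda>s. A s * (\<psi> r s - s * f2 (r, s)) - r\<^sup>2 * \<psi> r s", OF _ b0(1)])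
      show "continuous_on {0..b} (\<lambda>s. A s * (\<psi> r s - s * f2 (r, s)) - r\<^sup>2 * \<psi> r s)"
        by (intro continuous_intros contA cont' b0(2))
    next
      fix s assume s: "0 < s" "s < b"
      then have "s \<notin> Z" using b(2)[of s] by linarith
      then have "A s > 0" using s b0 by (simp add: Z_def)
      then show "A s * (\<psi> r s - s * f2 (r, s)) - r\<^sup>2 * \<psi> r s = 0"
        using onD(1)[of s] s b0 by simp
    qed
    moreover have "A b * (\<psi> r b - b * f2 (r, b)) \<le> 0"
      using pos(2)[of b] b0 by (simp add: mult_nonpos_nonneg)
    moreover have "r\<^sup>2 * \<psi> r b > 0" using pos(1)[of b] b0 r by simp
    ultimately show False by linarith
  qed
  \<comment> \<open>At s = r the root w vanishes while \<open>f12\<close> stays finite, so this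
    equation reduces to c2 r^3 psi(r, r) = 0.\<close>
  have "w r * (A r)\<^sup>2 * f12 (r, r) - r\<^sup>2 * \<psi> r r * (c1 * w r - c2 * r) = 0"
  proof (rule continuous_zero_at_endpoint[where
        f = "\<lambda>s. w s * (A s)\<^sup>2 * f12 (r, s) - r\<^sup>2 * \<psi> r s * (c1 * w s - c2 * s)", OF _ r(1)])
    show "continuous_on {0..r} (\<lambda>s. w s * (A s)\<^sup>2 * f12 (r, s) - r\<^sup>2 * \<psi> r s * (c1 * w s - c2 * s))"
      by (intro continuous_intros contA contw cont' order_refl)
  next
    fix s assume "0 < s" "s < r"
    then show "w s * (A s)\<^sup>2 * f12 (r, s) - r\<^sup>2 * \<psi> r s * (c1 * w s - c2 * s) = 0"
      using onD(2)[of s] A_pos[of s] by simp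
  qed
  then show False
    using pos(1)[of r] r(1) assms(2) by (simp add: w_def)
qed

section \<open>The spray and its third derivatives\<close>

definition orth :: "real^'n \<Rightarrow> real^'n \<Rightarrow> real^'n" where
  "orth x y = y - ((x \<bullet> y) / (x \<bullet> x)) *\<^sub>R x"

text \<open>The matrix of the projection \<open>orth x\<close>, and hence the derivative of its
  components with respect to y.\<close>

definition orth_coeff :: "real^'n \<Rightarrow> 'n \<Rightarrow> 'n \<Rightarrow> real" where
  "orth_coeff x i j = (if i = j then 1 else 0) - x $ i * x $ j / (x \<bullet> x)"

text \<open>The root of the Gram determinant, which is |x| |Y| with Y = \<open>orth x y\<close>, and
  u w in the notation of the metric. The expression under the root is a quadratic form in y, which
  makes it easier to differentiate than |Y|.\<close>

definition gram_root :: "real^'n \<Rightarrow> real^'n \<Rightarrow> real" where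
  "gram_root x y = sqrt ((x \<bullet> x) * (y \<bullet> y) - (x \<bullet> y)\<^sup>2)"

lemma inner_orth: "x \<noteq> 0 \<Longrightarrow> x \<bullet> orth x y = 0"
  by (simp add: orth_def inner_diff_right)

lemma inner_orth_self:
  assumes "x \<noteq> 0" and "gram_root x y > 0"
  shows "orth x y \<bullet> orth x y = (gram_root x y)\<^sup>2 / (x \<bullet> x)"
proof -
  have "orth x y \<bullet> orth x y = orth x y \<bullet> (y - ((x \<bullet> y) / (x \<bullet> x)) *\<^sub>R x)"
    by (simp only: orth_def)
  also have "\<dots> = orth x y \<bullet> y"
    using inner_orth[OF assms(1), of y] by (simp add: inner_diff_right inner_commute)
  also have "\<dots> = ((x \<bullet> x) * (y \<bullet> y) - (x \<bullet> y)\<^sup>2) / (x \<bullet> x)"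
    using assms(1) by (simp add: orth_def inner_diff_left field_simps power2_eq_square)
  also have "(x \<bullet> x) * (y \<bullet> y) - (x \<bullet> y)\<^sup>2 = (gram_root x y)\<^sup>2"
    using assms(2) by (simp add: gram_root_def)
  finally show ?thesis .
qed

lemma sum_orth_coeff: "(\<Sum>i\<in>UNIV. orth_coeff x i j * z $ i) = orth x z $ j"
proof -
  have "orth_coeff x i j * z $ i = (if i = j then z $ i else 0) - x $ i * z $ i * (x $ j / (x \<bullet> x))"
    for i by (simp add: orth_coeff_def algebra_simps)
  then have "(\<Sum>i\<in>UNIV. orth_coeff x i j * z $ i) = z $ j - (x \<bullet> z) * (x $ j / (x \<bullet> x))"
    by (simp only: sum_subtractf inner_vec_def flip: sum_distrib_right) simp
  then show ?thesis by (simp add: orth_def)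
qed

section \<open>Derivatives along coordinate lines\<close>

lemma DERIV_line:
  fixes x y :: "real^'n"
  shows DERIV_line_component:
      "((\<lambda>t. (y + t *\<^sub>R axis j 1) $ i) has_real_derivative (if i = j then 1 else 0)) (at 0)"
    and DERIV_line_inner:
      "((\<lambda>t. x \<bullet> (y + t *\<^sub>R axis j 1)) has_real_derivative x $ j) (at 0)"
    and DERIV_line_inner_self:
      "((\<lambda>t. (y + t *\<^sub>R axis j 1) \<bullet> (y + t *\<^sub>R axis j 1)) has_real_derivative 2 * y $ j) (at 0)"
proof -
  show "((\<lambda>t. (y + t *\<^sub>R axis j 1) $ i) has_real_derivative (if i = j then 1 else 0)) (at 0)"
    by (auto simp: axis_def intro!: derivative_eq_intros)
  show *: "((\<lambda>t. x \<bullet> (y + t *\<^sub>R axis j 1)) has_real_derivative x $ j) (at 0)" for x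
    by (auto simp: inner_add_right inner_axis intro!: derivative_eq_intros)
  have "(y + t *\<^sub>R axis j 1) \<bullet> (y + t *\<^sub>R axis j 1) = y \<bullet> y + 2 * t * y $ j + t\<^sup>2" for t :: real
    by (simp add: inner_add_right inner_add_left inner_axis inner_axis' power2_eq_square algebra_simps)
  then show "((\<lambda>t. (y + t *\<^sub>R axis j 1) \<bullet> (y + t *\<^sub>R axis j 1)) has_real_derivative 2 * y $ j) (at 0)"
    by (auto intro!: derivative_eq_intros)
qed

lemma DERIV_line_orth:
  "((\<lambda>t. orth x (y + t *\<^sub>R axis j 1) $ i) has_real_derivative orth_coeff x i j) (at 0)"
proof -
  have "((\<lambda>t. (y + t *\<^sub>R axis j 1) $ i - (x \<bullet> (y + t *\<^sub>R axis j 1)) / (x \<bullet> x) * x $ i)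
      has_real_derivative (if i = j then 1 else 0) - x $ j / (x \<bullet> x) * x $ i) (at 0)"
    by (intro DERIV_diff DERIV_line DERIV_cmult_right DERIV_cdivide)
  then show ?thesis by (simp add: orth_def orth_coeff_def mult.commute)
qed

lemma DERIV_line_gram_root:
  assumes "x \<noteq> 0" and "gram_root x y > 0"
  shows "((\<lambda>t. gram_root x (y + t *\<^sub>R axis j 1)) has_real_derivative
    (x \<bullet> x) * orth x y $ j / gram_root x y) (at 0)"
proof -
  have "((\<lambda>t. (x \<bullet> x) * ((y + t *\<^sub>R axis j 1) \<bullet> (y + t *\<^sub>R axis j 1)) - (x \<bullet> (y + t *\<^sub>R axis j 1))\<^sup>2)
      has_real_derivative (x \<bullet> x) * (2 * y $ j) - 2 * (x \<bullet> y) * x $ j) (at 0)"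
    by (rule derivative_eq_intros DERIV_line refl | simp)+
  moreover have "(sqrt has_real_derivative inverse (gram_root x y) / 2)
      (at ((x \<bullet> x) * ((y + 0 *\<^sub>R axis j 1) \<bullet> (y + 0 *\<^sub>R axis j 1))
        - (x \<bullet> (y + 0 *\<^sub>R axis j 1))\<^sup>2))"
    using assms(2) DERIV_real_sqrt[of "(x \<bullet> x) * (y \<bullet> y) - (x \<bullet> y)\<^sup>2"]
    by (simp add: gram_root_def)
  ultimately have "((\<lambda>t. gram_root x (y + t *\<^sub>R axis j 1)) has_real_derivative
      inverse (gram_root x y) / 2 * ((x \<bullet> x) * (2 * y $ j) - 2 * (x \<bullet> y) * x $ j)) (at 0)"
    unfolding gram_root_def by (rule DERIV_chain2[rotated])
  moreover have "inverse (gram_root x y) / 2 * ((x \<bullet> x) * (2 * y $ j) - 2 * (x \<bullet> y) * x $ j)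
      = (x \<bullet> x) * orth x y $ j / gram_root x y"
    using assms by (simp add: orth_def field_simps)
  ultimately show ?thesis by simp
qed

text \<open>Iterated partial derivatives are computed one at a time from closed forms that hold only
  on the tangent domain. Openness keeps a short piece of the coordinate line inside it.\<close>

lemma pd_eqI:
  assumes "((\<lambda>t. g (y + t *\<^sub>R axis j 1)) has_real_derivative d) (at 0)"
    and "open S" "y \<in> S" and "\<And>y. y \<in> S \<Longrightarrow> f y = g y"
  shows "pd j f y = d"
proof -
  have "continuous_on UNIV (\<lambda>t::real. y + t *\<^sub>R axis j 1)" by (intro continuous_intros)
  then have "open ((\<lambda>t::real. y + t *\<^sub>R axis j 1) -` S)"
    using assms(2) by (rule open_vimage[rotated])
  then have "((\<lambda>t. f (y + t *\<^sub>R axis j 1)) has_real_derivative d) (at 0)"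
    by (rule has_field_derivative_transform_within_open[OF assms(1)]) (use assms(3,4) in auto)
  then show ?thesis by (simp add: pd_def DERIV_imp_deriv)
qed

section \<open>The spray in closed form\<close>

lemma open_tangent_slice:
  assumes "open D"
  shows "open {y. (x, y) \<in> tangent_domain D}"
proof -
  have "continuous_on (- {0}) (\<lambda>y. (norm x, x \<bullet> y / norm y))"
    by (intro continuous_intros) auto
  from continuous_open_preimage[OF this _ assms]
  have "open (- {0} \<inter> (\<lambda>y. (norm x, x \<bullet> y / norm y)) -` D)" by (simp add: open_Compl)
  moreover have "{y. (x, y) \<in> tangent_domain D} = - {0} \<inter> (\<lambda>y. (norm x, x \<bullet> y / norm y)) -` D"
    by (auto simp: tangent_domain_def)
  ultimately show ?thesis by simp
qed

text \<open>Strictness of |s| < r means that x and y are linearly independent, so the Gram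
  determinant is positive. This justifies every later division by \<open>gram_root\<close>.\<close>

lemma tangent_domain_gram_root:
  assumes "(x, y) \<in> tangent_domain (phi_domain r0 c1 c2)"
  shows "x \<noteq> 0" "y \<noteq> 0" "gram_root x y > 0"
    and "gram_root x y = norm y * sqrt ((norm x)\<^sup>2 - (x \<bullet> y / norm y)\<^sup>2)"
proof -
  have D: "(norm x, x \<bullet> y / norm y) \<in> phi_domain r0 c1 c2" and y: "y \<noteq> 0"
    using assms by (auto simp: tangent_domain_def)
  show "y \<noteq> 0" by fact
  show "x \<noteq> 0" using phi_domain_root(1)[OF D] by auto
  have "(x \<bullet> x) * (y \<bullet> y) - (x \<bullet> y)\<^sup>2 = (norm y)\<^sup>2 * ((norm x)\<^sup>2 - (x \<bullet> y / norm y)\<^sup>2)"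
    using y unfolding power2_norm_eq_inner[symmetric] by (simp add: field_simps)
  then show eq: "gram_root x y = norm y * sqrt ((norm x)\<^sup>2 - (x \<bullet> y / norm y)\<^sup>2)"
    unfolding gram_root_def by (simp only: real_sqrt_mult) simp
  show "gram_root x y > 0"
    unfolding eq using y phi_domain_root(2)[OF D] by simp
qed

text \<open>Up to a term that is quadratic in \<open>y\<close>, the spray is a multiple of \<open>\<bar>Y\<bar> Y\<close>, where \<open>Y\<close> is the
  component of \<open>y\<close> orthogonal to \<open>x\<close>.\<close>

lemma spray_phi:
  fixes x y :: "real^'n"
  assumes "c2\<^sup>2 - 4 * c1 - 4 \<noteq> 0" and "c1 \<noteq> -1"
    and \<Omega>: "(x, y) \<in> tangent_domain (phi_domain r0 c1 c2)"
  defines "a \<equiv> x \<bullet> x"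
  shows "spray (phi c1 c2) x y $ i =
    (x \<bullet> y) * y $ i / a + (c1 - 1) / (2 * a * (c1 + 1)) * (y \<bullet> y) * x $ i
      + - c1 / (a\<^sup>2 * (c1 + 1)) * (x \<bullet> y)\<^sup>2 * x $ i
      + c2 / (a * (c1 + 1)) * (gram_root x y * orth x y $ i)"
proof -
  have D: "(norm x, x \<bullet> y / norm y) \<in> phi_domain r0 c1 c2"
    using \<Omega> by (auto simp: tangent_domain_def)
  note nz = tangent_domain_gram_root[OF \<Omega>]
  define u v w W where "u = norm y" and "v = x \<bullet> y" and "w = sqrt ((norm x)\<^sup>2 - (v / u)\<^sup>2)"
    and "W = gram_root x y"
  have W: "W = u * w" using nz(4) by (simp add: W_def u_def w_def v_def)
  have u: "u > 0" "y \<bullet> y = u\<^sup>2" using nz(2) by (auto simp: u_def power2_norm_eq_inner)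
  have a: "a > 0" "(norm x)\<^sup>2 = a" "(norm x)^4 = a\<^sup>2"
    using nz(1) power_mult[of "norm x" 2 2] by (auto simp: a_def power2_norm_eq_inner)
  have c: "c1 + 1 \<noteq> 0" using assms(2) by (simp add: add_eq_0_iff)
  have "spray (phi c1 c2) x y $ i =
      u * (v / u / a + c2 * w / (a * (c1 + 1))) * y $ i
      + u\<^sup>2 * ((c1 - 1) / (2 * a * (c1 + 1)) - c1 * (v / u)\<^sup>2 / (a\<^sup>2 * (c1 + 1))
          - c2 * (v / u) * w / (a\<^sup>2 * (c1 + 1))) * x $ i"
    unfolding spray_def Let_def spray_P_phi[OF assms(1,2) D] spray_Q_phi[OF assms(1,2) D]
    by (simp add: a u_def v_def w_def)
  \<comment> \<open>The terms with w in u P y and u^2 Q x have coefficients in the ratio 1 : - v /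
    a. Together they give W times y - (v / a) x, which is the projection of y.\<close>
  also have "\<dots> = v * y $ i / a + (c1 - 1) / (2 * a * (c1 + 1)) * u\<^sup>2 * x $ i
      + - c1 / (a\<^sup>2 * (c1 + 1)) * v\<^sup>2 * x $ i
      + c2 / (a * (c1 + 1)) * (W * (y $ i - v / a * x $ i))"
  proof -
    define d where "d = c1 + 1"
    have d: "d \<noteq> 0" using c by (simp add: d_def)
    have "u * (v / u / a + c2 * w / (a * d)) * y $ i = v * y $ i / a + c2 / (a * d) * W * y $ i"
      using u(1) unfolding W by (simp add: field_simps)
    moreover have "u\<^sup>2 * ((c1 - 1) / (2 * a * d) - c1 * (v / u)\<^sup>2 / (a\<^sup>2 * d)
          - c2 * (v / u) * w / (a\<^sup>2 * d)) * x $ i =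
        (c1 - 1) / (2 * a * d) * u\<^sup>2 * x $ i + - c1 / (a\<^sup>2 * d) * v\<^sup>2 * x $ i
        - c2 / (a * d) * W * (v / a * x $ i)"
      using u(1) a(1) d unfolding W by (simp add: field_simps power2_eq_square)
    ultimately show ?thesis
      unfolding d_def[symmetric] by (simp add: algebra_simps)
  qed
  finally show ?thesis by (simp add: u(2) v_def W_def orth_def a_def)
qed

section \<open>Iterated derivatives of the spray and the Berwald tensor\<close>

lemma pd_spray_phi:
  fixes x y :: "real^'n"
  assumes "c2\<^sup>2 - 4 * c1 - 4 \<noteq> 0" and "c1 \<noteq> -1"
    and \<Omega>: "(x, y) \<in> tangent_domain (phi_domain r0 c1 c2)"
  defines "a \<equiv> x \<bullet> x" and "W \<equiv> gram_root x" and "Y \<equiv> orth x" and "b \<equiv> orth_coeff x"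
  shows "pd h (\<lambda>y. spray (phi c1 c2) x y $ i) y =
    x $ h * y $ i / a + (x \<bullet> y) * (if i = h then 1 else 0) / a
      + (c1 - 1) / (2 * a * (c1 + 1)) * (2 * y $ h) * x $ i
      + - c1 / (a\<^sup>2 * (c1 + 1)) * (2 * (x \<bullet> y) * x $ h) * x $ i
      + c2 / (a * (c1 + 1)) * (a * (Y y $ h * Y y $ i) / W y + W y * b i h)"
proof (rule pd_eqI[OF _ open_tangent_slice[OF open_phi_domain]])
  note nz = tangent_domain_gram_root[OF \<Omega>]
  show "y \<in> {y. (x, y) \<in> tangent_domain (phi_domain r0 c1 c2)}" using \<Omega> by simp
  show "spray (phi c1 c2) x y $ i =
      (x \<bullet> y) * y $ i / a + (c1 - 1) / (2 * a * (c1 + 1)) * (y \<bullet> y) * x $ i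
      + - c1 / (a\<^sup>2 * (c1 + 1)) * (x \<bullet> y)\<^sup>2 * x $ i
      + c2 / (a * (c1 + 1)) * (W y * Y y $ i)"
    if "y \<in> {y. (x, y) \<in> tangent_domain (phi_domain r0 c1 c2)}" for y
    using that unfolding a_def W_def Y_def by (intro spray_phi[OF assms(1,2)]) simp
  show "((\<lambda>t. (x \<bullet> (y + t *\<^sub>R axis h 1)) * (y + t *\<^sub>R axis h 1) $ i / a
      + (c1 - 1) / (2 * a * (c1 + 1)) * ((y + t *\<^sub>R axis h 1) \<bullet> (y + t *\<^sub>R axis h 1)) * x $ i
      + - c1 / (a\<^sup>2 * (c1 + 1)) * (x \<bullet> (y + t *\<^sub>R axis h 1))\<^sup>2 * x $ i
      + c2 / (a * (c1 + 1)) * (W (y + t *\<^sub>R axis h 1) * Y (y + t *\<^sub>R axis h 1) $ i))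
    has_real_derivative
    x $ h * y $ i / a + (x \<bullet> y) * (if i = h then 1 else 0) / a
      + (c1 - 1) / (2 * a * (c1 + 1)) * (2 * y $ h) * x $ i
      + - c1 / (a\<^sup>2 * (c1 + 1)) * (2 * (x \<bullet> y) * x $ h) * x $ i
      + c2 / (a * (c1 + 1)) * (a * (Y y $ h * Y y $ i) / W y + W y * b i h)) (at 0)"
    (is "((\<lambda>t. ?p t + ?r t + ?s t + ?K * (?f t)) has_real_derivative
      ?p' + ?q' + ?r' + ?s' + ?K * ?f') _")
  proof (intro DERIV_add DERIV_cmult)
    have "(?p has_real_derivative (x $ h * y $ i + (if i = h then 1 else 0) * (x \<bullet> y)) / a) (at 0)"
      by (rule DERIV_cong, rule DERIV_cdivide[OF DERIV_mult[OF DERIV_line_inner DERIV_line_component]])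
        simp
    then show "(?p has_real_derivative ?p' + ?q') (at 0)"
      by (simp only: add_divide_distrib mult.commute[of "x \<bullet> y"])
    show "(?r has_real_derivative ?r') (at 0)"
      by (intro DERIV_line DERIV_cmult DERIV_cmult_right)
    have "((\<lambda>t. (x \<bullet> (y + t *\<^sub>R axis h 1))\<^sup>2) has_real_derivative 2 * (x \<bullet> y) * x $ h) (at 0)"
      by (rule DERIV_cong, rule DERIV_power[OF DERIV_line_inner]) simp
    then show "(?s has_real_derivative ?s') (at 0)"
      by (intro DERIV_cmult DERIV_cmult_right)
    show "(?f has_real_derivative ?f') (at 0)"
      unfolding W_def Y_def a_def b_def
      by (rule DERIV_cong, rule DERIV_mult[OF DERIV_line_gram_root[OF nz(1,3)] DERIV_line_orth])
        simp
  qed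
qed

text \<open>The quadratic part of the spray has become constant in y here, so only the summand with
  the factor c2 contributes to the third derivative.\<close>

lemma pd_pd_spray_phi:
  fixes x y :: "real^'n"
  assumes "c2\<^sup>2 - 4 * c1 - 4 \<noteq> 0" and "c1 \<noteq> -1"
    and \<Omega>: "(x, y) \<in> tangent_domain (phi_domain r0 c1 c2)"
  defines "a \<equiv> x \<bullet> x" and "W \<equiv> gram_root x" and "Y \<equiv> orth x" and "b \<equiv> orth_coeff x"
  shows "pd k (pd h (\<lambda>y. spray (phi c1 c2) x y $ i)) y =
    x $ h * (if i = k then 1 else 0) / a + x $ k * (if i = h then 1 else 0) / a
      + (c1 - 1) / (2 * a * (c1 + 1)) * (2 * (if h = k then 1 else 0)) * x $ i
      + - c1 / (a\<^sup>2 * (c1 + 1)) * (2 * x $ k * x $ h) * x $ i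
      + c2 / (a * (c1 + 1)) *
        (a * (b h k * Y y $ i + Y y $ h * b i k + Y y $ k * b i h) / W y
         - a\<^sup>2 * (Y y $ h * Y y $ i * Y y $ k) / (W y)^3)"
proof (rule pd_eqI[OF _ open_tangent_slice[OF open_phi_domain]])
  note nz = tangent_domain_gram_root[OF \<Omega>]
  have W0: "gram_root x (y + 0 *\<^sub>R axis k 1) \<noteq> 0" using nz(3) by simp
  show "y \<in> {y. (x, y) \<in> tangent_domain (phi_domain r0 c1 c2)}" using \<Omega> by simp
  show "pd h (\<lambda>y. spray (phi c1 c2) x y $ i) y =
      x $ h * y $ i / a + (x \<bullet> y) * (if i = h then 1 else 0) / a
      + (c1 - 1) / (2 * a * (c1 + 1)) * (2 * y $ h) * x $ i
      + - c1 / (a\<^sup>2 * (c1 + 1)) * (2 * (x \<bullet> y) * x $ h) * x $ i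
      + c2 / (a * (c1 + 1)) * (a * (Y y $ h * Y y $ i) / W y + W y * b i h)"
    if "y \<in> {y. (x, y) \<in> tangent_domain (phi_domain r0 c1 c2)}" for y
    using that unfolding a_def W_def Y_def b_def by (intro pd_spray_phi[OF assms(1,2)]) simp
  show "((\<lambda>t. x $ h * (y + t *\<^sub>R axis k 1) $ i / a
      + (x \<bullet> (y + t *\<^sub>R axis k 1)) * (if i = h then 1 else 0) / a
      + (c1 - 1) / (2 * a * (c1 + 1)) * (2 * (y + t *\<^sub>R axis k 1) $ h) * x $ i
      + - c1 / (a\<^sup>2 * (c1 + 1)) * (2 * (x \<bullet> (y + t *\<^sub>R axis k 1)) * x $ h) * x $ i
      + c2 / (a * (c1 + 1)) *
        (a * (Y (y + t *\<^sub>R axis k 1) $ h * Y (y + t *\<^sub>R axis k 1) $ i) / W (y + t *\<^sub>R axis k 1)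
         + W (y + t *\<^sub>R axis k 1) * b i h))
    has_real_derivative
    x $ h * (if i = k then 1 else 0) / a + x $ k * (if i = h then 1 else 0) / a
      + (c1 - 1) / (2 * a * (c1 + 1)) * (2 * (if h = k then 1 else 0)) * x $ i
      + - c1 / (a\<^sup>2 * (c1 + 1)) * (2 * x $ k * x $ h) * x $ i
      + c2 / (a * (c1 + 1)) *
        (a * (b h k * Y y $ i + Y y $ h * b i k + Y y $ k * b i h) / W y
         - a\<^sup>2 * (Y y $ h * Y y $ i * Y y $ k) / (W y)^3)) (at 0)"
    (is "((\<lambda>t. ?p t + ?q t + ?r t + ?s t + ?K * (?f t)) has_real_derivative
      ?p' + ?q' + ?r' + ?s' + ?K * ?f') _")
  proof (intro DERIV_add DERIV_cmult)
    show "(?p has_real_derivative ?p') (at 0)"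
      by (intro DERIV_line DERIV_cmult DERIV_cdivide)
    show "(?q has_real_derivative ?q') (at 0)"
      by (intro DERIV_line DERIV_cmult_right DERIV_cdivide)
    show "(?r has_real_derivative ?r') (at 0)"
      by (intro DERIV_line DERIV_cmult DERIV_cmult_right)
    show "(?s has_real_derivative ?s') (at 0)"
      by (intro DERIV_line DERIV_cmult DERIV_cmult_right)
    show "(?f has_real_derivative ?f') (at 0)"
      unfolding W_def Y_def a_def b_def
      by (rule DERIV_cong, rule DERIV_add[OF
            DERIV_divide[OF DERIV_cmult[OF DERIV_mult[OF DERIV_line_orth DERIV_line_orth]]
              DERIV_line_gram_root[OF nz(1,3)] W0]
            DERIV_cmult_right[OF DERIV_line_gram_root[OF nz(1,3)]]])
        (use nz(3) in \<open>simp add: field_simps power2_eq_square power3_eq_cube\<close>)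
  qed
qed

text \<open>The terms are grouped by how the upper index i enters, through a column of the
  projection matrix or through Y. Contraction over i then requires just two sums.\<close>

lemma berwald_tensor_phi:
  fixes x y :: "real^'n"
  assumes "c2\<^sup>2 - 4 * c1 - 4 \<noteq> 0" and "c1 \<noteq> -1"
    and \<Omega>: "(x, y) \<in> tangent_domain (phi_domain r0 c1 c2)"
  defines "a \<equiv> x \<bullet> x" and "W \<equiv> gram_root x y" and "Y \<equiv> orth x y" and "b \<equiv> orth_coeff x"
  shows "berwald_tensor (spray (phi c1 c2)) x y i j k h = c2 / (a * (c1 + 1)) *
    ((a * b h k / W - a\<^sup>2 * (Y $ h * Y $ k) / W^3) * b i j
   + (a * b h j / W - a\<^sup>2 * (Y $ h * Y $ j) / W^3) * b i k
   + (a * b k j / W - a\<^sup>2 * (Y $ k * Y $ j) / W^3) * b i h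
   + (3 * a^3 * (Y $ h * Y $ k * Y $ j) / W^5
      - a\<^sup>2 * (b h k * Y $ j + b h j * Y $ k + b k j * Y $ h) / W^3) * Y $ i)"
  unfolding berwald_tensor_def
proof (rule pd_eqI[OF _ open_tangent_slice[OF open_phi_domain]])
  note nz = tangent_domain_gram_root[OF \<Omega>]
  have W0: "gram_root x (y + 0 *\<^sub>R axis j 1) \<noteq> 0"
    and W3: "gram_root x (y + 0 *\<^sub>R axis j 1) ^ 3 \<noteq> 0" using nz(3) by simp_all
  define c where "c = x $ h * (if i = k then 1 else 0) / a + x $ k * (if i = h then 1 else 0) / a
      + (c1 - 1) / (2 * a * (c1 + 1)) * (2 * (if h = k then 1 else 0)) * x $ i
      + - c1 / (a\<^sup>2 * (c1 + 1)) * (2 * x $ k * x $ h) * x $ i"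
  let ?f = "\<lambda>y. a * (b h k * orth x y $ i + orth x y $ h * b i k + orth x y $ k * b i h) / gram_root x y
         - a\<^sup>2 * (orth x y $ h * orth x y $ i * orth x y $ k) / (gram_root x y)^3"
  show "y \<in> {y. (x, y) \<in> tangent_domain (phi_domain r0 c1 c2)}" using \<Omega> by simp
  show "pd k (pd h (\<lambda>y. spray (phi c1 c2) x y $ i)) y = c + c2 / (a * (c1 + 1)) * ?f y"
    if "y \<in> {y. (x, y) \<in> tangent_domain (phi_domain r0 c1 c2)}" for y
    using that unfolding a_def b_def c_def by (intro pd_pd_spray_phi[OF assms(1,2)]) simp
  let ?D = "(a * b h k / W - a\<^sup>2 * (Y $ h * Y $ k) / W^3) * b i j
   + (a * b h j / W - a\<^sup>2 * (Y $ h * Y $ j) / W^3) * b i k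
   + (a * b k j / W - a\<^sup>2 * (Y $ k * Y $ j) / W^3) * b i h
   + (3 * a^3 * (Y $ h * Y $ k * Y $ j) / W^5
      - a\<^sup>2 * (b h k * Y $ j + b h j * Y $ k + b k j * Y $ h) / W^3) * Y $ i"
  \<comment> \<open>The output of the quotient rule is simplified with all matrix entries and
    components replaced by independent variables, so this is a purely rational identity.\<close>
  have alg: "(a * (bhk * bij + bhj * bik + bkj * bih) * W - a * (bhk * Yi + Yh * bik + Yk * bih) * (a * Yj / W)) / (W * W)
      - (a\<^sup>2 * ((bhj * Yi + bij * Yh) * Yk + bkj * (Yh * Yi)) * W^3
         - a\<^sup>2 * (Yh * Yi * Yk) * (3 * (a * Yj / W * W\<^sup>2))) / (W^3 * W^3)
    = (a * bhk / W - a\<^sup>2 * (Yh * Yk) / W^3) * bij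
   + (a * bhj / W - a\<^sup>2 * (Yh * Yj) / W^3) * bik
   + (a * bkj / W - a\<^sup>2 * (Yk * Yj) / W^3) * bih
   + (3 * a^3 * (Yh * Yk * Yj) / W^5 - a\<^sup>2 * (bhk * Yj + bhj * Yk + bkj * Yh) / W^3) * Yi"
    if "W \<noteq> 0" for bhk bij bhj bik bkj bih Yi Yh Yk Yj :: real
    using that by (simp add: divide_simps) (simp add: algebra_simps eval_nat_numeral)
  have "((\<lambda>t. ?f (y + t *\<^sub>R axis j 1)) has_real_derivative ?D) (at 0)"
    unfolding b_def
    by (rule DERIV_cong, rule DERIV_diff[OF
          DERIV_divide[OF DERIV_cmult[OF DERIV_add[OF DERIV_add[OF
              DERIV_cmult[OF DERIV_line_orth] DERIV_cmult_right[OF DERIV_line_orth]]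
              DERIV_cmult_right[OF DERIV_line_orth]]]
            DERIV_line_gram_root[OF nz(1,3)] W0]
          DERIV_divide[OF DERIV_cmult[OF DERIV_mult[OF DERIV_mult[OF
              DERIV_line_orth DERIV_line_orth] DERIV_line_orth]]
            DERIV_power[OF DERIV_line_gram_root[OF nz(1,3)]] W3]],
        unfold scaleR_zero_left add_0_right a_def[symmetric] b_def[symmetric]
          Y_def[symmetric] W_def[symmetric])
      (use alg nz(3) in \<open>simp add: W_def numeral_2_eq_2\<close>)
  then have "((\<lambda>t. c + c2 / (a * (c1 + 1)) * ?f (y + t *\<^sub>R axis j 1))
      has_real_derivative 0 + c2 / (a * (c1 + 1)) * ?D) (at 0)"
    by (intro DERIV_add DERIV_const DERIV_cmult)
  then show "((\<lambda>t. c + c2 / (a * (c1 + 1)) * ?f (y + t *\<^sub>R axis j 1))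
      has_real_derivative c2 / (a * (c1 + 1)) * ?D) (at 0)"
    by simp
qed

section \<open>The Landsberg tensor\<close>

lemma pd_sph_metric_phi:
  fixes x y :: "real^'n"
  assumes \<Delta>: "c2\<^sup>2 - 4 * c1 - 4 \<noteq> 0" and \<Omega>: "(x, y) \<in> tangent_domain (phi_domain r0 c1 c2)"
  obtains p q where "\<And>i. pd i (sph_metric (phi c1 c2) x) y = p * y $ i + q * x $ i"
proof -
  have D: "(norm x, x \<bullet> y / norm y) \<in> phi_domain r0 c1 c2" and y: "norm y > 0"
    using \<Omega> by (auto simp: tangent_domain_def)
  let ?s = "x \<bullet> y / norm y"
  obtain e where e: "((\<lambda>s. phi c1 c2 (norm x) s) has_real_derivative e) (at ?s)"
    using has_partials_DERIV_snd[OF has_partials_phi[OF \<Delta> D]] by auto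
  have "pd i (sph_metric (phi c1 c2) x) y =
      (phi c1 c2 (norm x) ?s / norm y - e * (x \<bullet> y) / (norm y)\<^sup>2) * y $ i + e * x $ i" for i
  proof (rule pd_eqI[OF _ open_UNIV UNIV_I])
    have "(sqrt has_real_derivative inverse (norm y) / 2)
        (at ((y + 0 *\<^sub>R axis i 1) \<bullet> (y + 0 *\<^sub>R axis i 1)))"
      using DERIV_real_sqrt[of "y \<bullet> y"] y by (simp add: norm_eq_sqrt_inner)
    from DERIV_chain2[OF this DERIV_line_inner_self]
    have n: "((\<lambda>t. norm (y + t *\<^sub>R axis i 1)) has_real_derivative y $ i / norm y) (at 0)"
      by (simp add: norm_eq_sqrt_inner field_simps)
    have s: "((\<lambda>t. x \<bullet> (y + t *\<^sub>R axis i 1) / norm (y + t *\<^sub>R axis i 1)) has_real_derivative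
        (x $ i * norm y - (x \<bullet> y) * (y $ i / norm y)) / (norm y * norm y)) (at 0)"
      using DERIV_divide[OF DERIV_line_inner n] y by simp
    have "((\<lambda>s. phi c1 c2 (norm x) s) has_real_derivative e)
        (at (x \<bullet> (y + 0 *\<^sub>R axis i 1) / norm (y + 0 *\<^sub>R axis i 1)))"
      using e by simp
    from DERIV_mult[OF n DERIV_chain2[OF this s]]
    show "((\<lambda>t. norm (y + t *\<^sub>R axis i 1) * phi c1 c2 (norm x)
          (x \<bullet> (y + t *\<^sub>R axis i 1) / norm (y + t *\<^sub>R axis i 1))) has_real_derivative
        (phi c1 c2 (norm x) ?s / norm y - e * (x \<bullet> y) / (norm y)\<^sup>2) * y $ i + e * x $ i) (at 0)"
      by (rule DERIV_cong) (use y in \<open>simp add: field_simps power2_eq_square\<close>)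
  qed (simp add: sph_metric_def)
  then show ?thesis by (rule that)
qed


lemma landsberg_on_phi:
  assumes \<Delta>: "c2\<^sup>2 - 4 * c1 - 4 \<noteq> 0" and "c1 \<noteq> -1"
  shows "landsberg_on (tangent_domain (phi_domain r0 c1 c2) :: ((real^'n) \<times> (real^'n)) set)
    (sph_metric (phi c1 c2)) (spray (phi c1 c2))"
proof -
  have "landsberg_tensor (sph_metric (phi c1 c2)) (spray (phi c1 c2)) x y j k h = 0"
    if \<Omega>: "(x, y) \<in> tangent_domain (phi_domain r0 c1 c2)" for x y :: "real^'n" and j k h
  proof -
    note nz = tangent_domain_gram_root[OF \<Omega>]
    define a W Y b where "a = x \<bullet> x" and "W = gram_root x y" and "Y = orth x y"
      and "b = orth_coeff x"
    have a: "a \<noteq> 0" and W: "W \<noteq> 0" using nz(1,3) by (simp_all add: a_def W_def)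
    \<comment> \<open>The contraction below vanishes whatever p and q are, so the gradient of F
      enters only through its shape.\<close>
    obtain p q where pq: "\<And>i. pd i (sph_metric (phi c1 c2) x) y = p * y $ i + q * x $ i"
      using pd_sph_metric_phi[OF \<Delta> \<Omega>] by blast
    have "orth x (p *\<^sub>R y + q *\<^sub>R x) = p *\<^sub>R Y"
      using nz(1) by (simp add: orth_def Y_def inner_add_right algebra_simps add_divide_distrib)
    with sum_orth_coeff[of x _ "p *\<^sub>R y + q *\<^sub>R x"]
    have sum_b: "(\<Sum>i\<in>UNIV. b i m * (p * y $ i + q * x $ i)) = p * Y $ m" for m
      by (simp add: b_def)
    have "Y \<bullet> y = Y \<bullet> (Y + ((x \<bullet> y) / (x \<bullet> x)) *\<^sub>R x)" by (simp add: Y_def orth_def)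
    also have "\<dots> = W\<^sup>2 / a"
      using inner_orth_self[OF nz(1,3)] inner_orth[OF nz(1), of y]
      by (simp add: inner_add_right Y_def W_def a_def inner_commute)
    finally have Yy: "Y \<bullet> y = W\<^sup>2 / a" .
    have "(\<Sum>i\<in>UNIV. Y $ i * (p * y $ i + q * x $ i)) = Y \<bullet> (p *\<^sub>R y + q *\<^sub>R x)"
      by (simp add: inner_vec_def)
    also have "\<dots> = p * (W\<^sup>2 / a)"
      using inner_orth[OF nz(1), of y] by (simp add: inner_add_right Yy) (simp add: Y_def inner_commute)
    finally have sum_Y: "(\<Sum>i\<in>UNIV. Y $ i * (p * y $ i + q * x $ i)) = p * (W\<^sup>2 / a)" .
    have contract: "(\<Sum>i\<in>UNIV. K * (cj * b i j + ck * b i k + ch * b i h + d * Y $ i)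
        * (p * y $ i + q * x $ i)) = K * p * (cj * Y $ j + ck * Y $ k + ch * Y $ h + d * (W\<^sup>2 / a))"
      for K cj ck ch d
    proof -
      have "(\<Sum>i\<in>UNIV. K * (cj * b i j + ck * b i k + ch * b i h + d * Y $ i)
          * (p * y $ i + q * x $ i)) =
          (\<Sum>i\<in>UNIV. K * (cj * (b i j * (p * y $ i + q * x $ i))
            + ck * (b i k * (p * y $ i + q * x $ i))
            + ch * (b i h * (p * y $ i + q * x $ i)) + d * (Y $ i * (p * y $ i + q * x $ i))))"
        by (rule sum.cong) (simp_all add: algebra_simps)
      also have "\<dots> = K * (cj * (p * Y $ j) + ck * (p * Y $ k) + ch * (p * Y $ h) + d * (p * (W\<^sup>2 / a)))"
        by (simp only: sum.distrib sum_b sum_Y flip: sum_distrib_left)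
      finally show ?thesis by (simp add: algebra_simps)
    qed
    \<comment> \<open>The contraction up to its common factor. Since |Y|^2 = W^2 / a, each term b Y
      / W meets its negative from the last bracket, and the three cubic terms cancel against the one
      with coefficient 3.\<close>
    have "(a * b h k / W - a\<^sup>2 * (Y $ h * Y $ k) / W^3) * Y $ j
        + (a * b h j / W - a\<^sup>2 * (Y $ h * Y $ j) / W^3) * Y $ k
        + (a * b k j / W - a\<^sup>2 * (Y $ k * Y $ j) / W^3) * Y $ h
        + (3 * a^3 * (Y $ h * Y $ k * Y $ j) / W^5
           - a\<^sup>2 * (b h k * Y $ j + b h j * Y $ k + b k j * Y $ h) / W^3) * (W\<^sup>2 / a) = 0"
      using a W by (simp add: divide_simps) (simp add: algebra_simps eval_nat_numeral)
    then show ?thesis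
      unfolding landsberg_tensor_def berwald_tensor_phi[OF assms \<Omega>] pq
        a_def[symmetric] b_def[symmetric] W_def[symmetric] Y_def[symmetric] contract
      by simp
  qed
  then show ?thesis unfolding landsberg_on_def by auto
qed

section \<open>The Berwald condition\<close>

lemma berwald_on_phi_zero:
  assumes "(0::real)\<^sup>2 - 4 * c1 - 4 \<noteq> 0" and "c1 \<noteq> -1"
  shows "berwald_on (tangent_domain (phi_domain r0 c1 0)) (spray (phi c1 0))"
  unfolding berwald_on_def using berwald_tensor_phi[OF assms] by auto

text \<open>The closed form of the tensor holds only on the tangent domain, so an explicit point of
  that set has to be produced for all admissible parameters. Both x and y are placed in the plane of
  two coordinate axes, which leaves a third axis orthogonal to it.\<close>

lemma not_berwald_on_phi:
  assumes \<Delta>: "c2\<^sup>2 - 4 * c1 - 4 \<noteq> 0" and "c1 \<noteq> -1" and "c2 \<noteq> 0" and "r0 > 0"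
    and card: "CARD('n::finite) \<ge> 3"
  shows "\<not> berwald_on (tangent_domain (phi_domain r0 c1 c2) :: ((real^'n) \<times> (real^'n)) set)
    (spray (phi c1 c2))"
proof
  assume B: "berwald_on (tangent_domain (phi_domain r0 c1 c2) :: ((real^'n) \<times> (real^'n)) set)
    (spray (phi c1 c2))"
  obtain S :: "'n set" where "card S = 3" using obtain_subset_with_card_n[OF card] by blast
  then obtain p q m :: 'n where pqm: "p \<noteq> q" "p \<noteq> m" "q \<noteq> m"
    by (auto simp: card_3_iff)
  define r where "r = r0 / 2"
  \<comment> \<open>With this \<open>t\<close>, |c1 t^2 + c2 t w| is at most (|c1| + |c2|) t < 1/2,
    so the radicand r^2 (1 + c1 t^2 + c2 t w) is positive. The point has s = r t, which is nonzero
    and below r.\<close>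
  define t where "t = 1 / (2 * (1 + \<bar>c1\<bar> + \<bar>c2\<bar>))"
  define w where "w = sqrt (1 - t\<^sup>2)"
  have t: "0 < t" "t \<le> 1 / 2" "(1 + \<bar>c1\<bar> + \<bar>c2\<bar>) * t = 1 / 2"
    by (auto simp: t_def field_simps add_nonneg_eq_0_iff intro!: add_pos_nonneg)
  have "t\<^sup>2 < 1" using t by (simp add: abs_square_less_1)
  then have w: "0 < w" "w \<le> 1" "w\<^sup>2 = 1 - t\<^sup>2" by (auto simp: w_def)
  define x y where "x = r *\<^sub>R axis p (1::real)" and "y = t *\<^sub>R axis p 1 + w *\<^sub>R axis q (1::real)"
  have r: "0 < r" "r < r0" using assms(4) by (auto simp: r_def)
  have x: "norm x = r" using r by (simp add: x_def norm_axis_1)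
  have "y \<bullet> y = 1"
    using pqm w(3) by (simp add: y_def inner_add_left inner_add_right inner_axis_axis power2_eq_square)
  then have y: "norm y = 1" by (simp add: norm_eq_sqrt_inner)
  have xy: "x \<bullet> y = r * t"
    using pqm by (simp add: x_def y_def inner_add_right inner_axis_axis)
  have "radicand c1 c2 r (r * t) = r\<^sup>2 * (1 + c1 * t\<^sup>2 + c2 * t * w)"
  proof -
    have "r\<^sup>2 - (r * t)\<^sup>2 = (r * w)\<^sup>2" unfolding power_mult_distrib w(3) by (simp add: algebra_simps)
    then have "sqrt (r\<^sup>2 - (r * t)\<^sup>2) = r * w" using r w by simp
    then show ?thesis by (simp add: radicand_def algebra_simps power2_eq_square)
  qed
  moreover have "\<bar>c1 * t\<^sup>2\<bar> \<le> \<bar>c1\<bar> * t"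
    using t by (auto simp: abs_mult power2_eq_square intro!: mult_left_mono mult_left_le)
  moreover have "\<bar>c2 * t * w\<bar> \<le> \<bar>c2\<bar> * t"
    using t w by (auto simp: abs_mult intro!: mult_left_le)
  moreover have "(\<bar>c1\<bar> + \<bar>c2\<bar>) * t < 1 / 2" using t by (simp add: algebra_simps)
  ultimately have "radicand c1 c2 r (r * t) > 0"
    using r by (simp add: distrib_right)
  moreover have "r * t < r" using r t by simp
  ultimately have \<Omega>: "(x, y) \<in> tangent_domain (phi_domain r0 c1 c2)"
    using x y xy r t by (auto simp: tangent_domain_def phi_domain_def)
  \<comment> \<open>Taking all four indices equal to m removes every term containing Y. Three equal
    terms a / W remain in the bracket.\<close>
  have "orth x y $ m = 0" "orth_coeff x m m = 1"
    using pqm by (simp_all add: orth_def orth_coeff_def x_def y_def axis_def)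
  with berwald_tensor_phi[OF \<Delta> assms(2) \<Omega>, of m m m m]
  have "berwald_tensor (spray (phi c1 c2)) x y m m m m
      = c2 / ((x \<bullet> x) * (c1 + 1)) * (3 * (x \<bullet> x) / gram_root x y)"
    by simp
  also have "\<dots> \<noteq> 0"
    using tangent_domain_gram_root[OF \<Omega>] assms(2,3) by (auto simp: add_eq_0_iff)
  finally show False using B \<Omega> by (auto simp: berwald_on_def)
qed

theorem theorem4p1:
  fixes r0 c1 c2 :: real
    and \<phi> :: "real \<Rightarrow> real \<Rightarrow> real"
    and D :: "(real \<times> real) set"
    and \<Omega> :: "((real^'n) \<times> (real^'n)) set"
    and F :: "real^'n \<Rightarrow> real^'n \<Rightarrow> real"
    and G :: "real^'n \<Rightarrow> real^'n \<Rightarrow> real^'n"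
  assumes "CARD('n) \<ge> 3"
    and "r0 > 0"
    and "c2\<^sup>2 - 4 * c1 - 4 \<noteq> 0"
    and "c1 \<noteq> -1"
  defines "\<phi> \<equiv> phi c1 c2"
    and "D \<equiv> phi_domain r0 c1 c2"
    and "\<Omega> \<equiv> tangent_domain D"
    and "F \<equiv> sph_metric \<phi>"
    and "G \<equiv> spray \<phi>"
  shows "(c2 \<noteq> 0 \<longrightarrow>
            sph_metric_on D \<phi> \<and> nonregular_sph r0 D \<phi> \<and>
            landsberg_on \<Omega> F G \<and> \<not> berwald_on \<Omega> G \<and>
            (\<forall>(r, s)\<in>D.
               spray_P \<phi> r s = s / r\<^sup>2 + c2 * sqrt (r\<^sup>2 - s\<^sup>2) / (r\<^sup>2 * (c1 + 1)) \<and>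
               spray_Q \<phi> r s = (c1 - 1) / (2 * r\<^sup>2 * (c1 + 1))
                 - c1 * s\<^sup>2 / (r^4 * (c1 + 1))
                 - c2 * s * sqrt (r\<^sup>2 - s\<^sup>2) / (r^4 * (c1 + 1)))) \<and>
         (berwald_on \<Omega> G \<longleftrightarrow> c2 = 0)"
proof -
  have not_berwald: "\<not> berwald_on \<Omega> G" if "c2 \<noteq> 0"
    unfolding \<Omega>_def G_def \<phi>_def D_def by (rule not_berwald_on_phi[OF assms(3,4) that assms(2,1)])
  moreover have "berwald_on \<Omega> G" if "c2 = 0"
    using berwald_on_phi_zero assms(3,4) unfolding \<Omega>_def G_def \<phi>_def D_def that by blast
  moreover have "landsberg_on \<Omega> F G"
    unfolding \<Omega>_def G_def F_def \<phi>_def D_def by (rule landsberg_on_phi[OF assms(3,4)])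
  moreover have "sph_metric_on D \<phi>"
    unfolding \<phi>_def D_def by (rule sph_metric_on_phi[OF assms(3,4)])
  moreover have "nonregular_sph r0 D \<phi>" if "c2 \<noteq> 0"
    unfolding \<phi>_def D_def by (rule nonregular_phi[OF assms(3) that assms(2)])
  ultimately show ?thesis
    using spray_P_phi[OF assms(3,4)] spray_Q_phi[OF assms(3,4)] unfolding \<phi>_def D_def by blast
qed

end
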